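(* Let $A:=\begin{bmatrix}A_{11}&A_{12}\\ 0&A_{22}\end{bmatrix}$ and $E:=\begin{bmatrix}E_{11}&E_{12}\\ E_{21}&E_{22}\end{bmatrix}$ be $n\times n$ complex matrices, where $A_{11}$ and $E_{11}$ are $m\times m$ matrices. Suppose that $s:=\mathrm{sep}(A_{22},A_{11})>0$ and $4\|E\|_2(\|E\|_2+\|A_{12}\|_2)<s^2$. Then the following hold. (a) There exists a unique matrix $X\in\mathbb{C}^{(n-m)\times m}$ such that $\left(\begin{bmatrix}I_m\\ X\end{bmatrix},M\right)$ and $\left(\begin{bmatrix}-X^*\\ I_{n-m}\end{bmatrix},N\right)$ are right and left invariant pairs of $A+E$, respectively, where $M:=A_{11}+E_{11}+(A_{12}+E_{12})X$ and $N:=A_{22}+E_{22}-X(A_{12}+E_{12})$. (b) Let $\mathcal{X}:=\mathrm{span}\begin{bmatrix}I_m\\ 0\end{bmatrix}$ and $\mathcal{X}_E:=\mathrm{span}\begin{bmatrix}I_m\\ X\end{bmatrix}$. Then $A\mathcal{X}\subset\mathcal{X}$ and $(A+E)\mathcal{X}_E\subset\mathcal{X}_E$. Further, $$\tan\theta_{\max}(\mathcal{X},\mathcal{X}_E)=\|X\|_2\le\frac{2\|E\|_2}{s+\sqrt{s^2-4(\|A_{12}\|_2+\|E\|_2)\|E\|_2}}\le\frac{2\|E\|_2}{s}.$$ (c) Let $\mathcal{Y}:=\mathrm{span}\begin{bmatrix}0\\ I_{n-m}\end{bmatrix}$ and $\mathcal{Y}_E:=\mathrm{span}\begin{bmatrix}-X^*\\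 I_{n-m}\end{bmatrix}$. Then $A^*\mathcal{Y}\subset\mathcal{Y}$ and $(A+E)^*\mathcal{Y}_E\subset\mathcal{Y}_E$. Further, $$\tan\theta_{\max}(\mathcal{Y},\mathcal{Y}_E)=\|X\|_2\le\frac{2\|E\|_2}{s+\sqrt{s^2-4(\|A_{12}\|_2+\|E\|_2)\|E\|_2}}\le\frac{2\|E\|_2}{s}.$$
   Context: $\|\cdot\|_2$ is the spectral norm, $I_k$ is the $k\times k$ identity matrix, $B^*$ is the conjugate transpose, and $\mathrm{span}(B)$ is the column space of a matrix $B$. The matrices $A$ and $E$ are partitioned conformably. For $B\in\mathbb{C}^{p\times p}$ and $C\in\mathbb{C}^{q\times q}$, $\mathrm{sep}(B,C):=\min\{\|BY-YC\|_2: Y\in\mathbb{C}^{p\times q},\ \|Y\|_2=1\}$. For $B\in\mathbb{C}^{n\times n}$, a pair $(X_0,M_0)\in\mathbb{C}^{n\times k}\times\mathbb{C}^{k\times k}$ is a right invariant pair of $B$ if $\mathrm{rank}(X_0)=k$ and $BX_0=X_0M_0$; a pair $(Y_0,L_0)\in\mathbb{C}^{n\times k}\times\mathbb{C}^{k\times k}$ is a left invariant pair of $B$ if $\mathrm{rank}(Y_0)=k$ and $Y_0^*B=L_0Y_0^*$. For two $k$-dimensional subspaces $\mathcal{U}=\mathrm{span}(U)$, $\mathcal{V}=\mathrm{span}(V)$ of $\mathbb{C}^n$ with $U^*U=V^*V=I_k$, the largest canonical angle $\theta_{\max}(\mathcal{U},\mathcal{V})\in[0,\pi/2]$ is defined by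 $\cos\theta_{\max}(\mathcal{U},\mathcal{V})=\sigma_{\min}(V^*U)$, where $\sigma_{\min}$ denotes the smallest singular value.
   Formalization: Uniqueness of X in (a) is asserted only among matrices with ‖X‖₂ ≤ 2‖E‖₂/s, since without a size bound it fails: for A=[[1,1],[0,2]], E=0, m=1, both X=0 and X=1 give right and left invariant pairs. *)

theory Defs
  imports "HOL-Analysis.Analysis"
begin

section \<open>Matrices\<close>

definition ctranspose :: "complex^'n^'m \<Rightarrow> complex^'m^'n"
  where "ctranspose B = (\<chi> i j. cnj (B $ j $ i))"

definition spec_norm :: "complex^'n^'m \<Rightarrow> real"
  where "spec_norm B = onorm ((*v) B)"

definition col_span :: "complex^'n^'m \<Rightarrow> (complex^'m) set"
  where "col_span B = vec.span (columns B)"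

text \<open>Block matrices are indexed by sum types, so that a square matrix with an $m \times m$ leading
  block has index type \<^typ>\<open>'m + 'k\<close> with $|k| = n - m$.\<close>

definition four_block ::
    "'a^'m::finite^'m \<Rightarrow> 'a^'k::finite^'m \<Rightarrow> 'a^'m^'k \<Rightarrow> 'a^'k^'k \<Rightarrow> 'a^('m + 'k)^('m + 'k)"
  where "four_block P Q R S =
    (\<chi> i j. case i of
        Inl a \<Rightarrow> (case j of Inl b \<Rightarrow> P $ a $ b | Inr b \<Rightarrow> Q $ a $ b)
      | Inr a \<Rightarrow> (case j of Inl b \<Rightarrow> R $ a $ b | Inr b \<Rightarrow> S $ a $ b))"

definition two_block :: "'a^'q^'m \<Rightarrow> 'a^'q^'k \<Rightarrow> 'a^'q^('m + 'k)"
  where "two_block P Q = (\<chi> i. case i of Inl a \<Rightarrow> P $ a | Inr a \<Rightarrow> Q $ a)"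

section \<open>Separation and invariant pairs\<close>

text \<open>The infimum is a minimum, see \<open>sep_attained\<close> below.\<close>

definition sep :: "complex^'p^'p \<Rightarrow> complex^'q^'q \<Rightarrow> real"
  where "sep B C = (INF Y \<in> {Y :: complex^'q^'p. spec_norm Y = 1}. spec_norm (B ** Y - Y ** C))"

definition right_invariant_pair :: "complex^'n^'n \<Rightarrow> complex^'k^'n \<Rightarrow> complex^'k^'k \<Rightarrow> bool"
  where "right_invariant_pair B X0 M0 \<longleftrightarrow> rank X0 = CARD('k) \<and> B ** X0 = X0 ** M0"

definition left_invariant_pair :: "complex^'n^'n \<Rightarrow> complex^'k^'n \<Rightarrow> complex^'k^'k \<Rightarrow> bool"
  where "left_invariant_pair B Y0 L0 \<longleftrightarrow>
    rank Y0 = CARD('k) \<and> ctranspose Y0 ** B = L0 ** ctranspose Y0"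

section \<open>Canonical angles\<close>

definition singular_values :: "complex^'n^'n \<Rightarrow> real set"
  where "singular_values B =
    {\<sigma>. 0 \<le> \<sigma> \<and> (\<exists>v. v \<noteq> 0 \<and> (ctranspose B ** B) *v v = complex_of_real (\<sigma>\<^sup>2) *s v)}"

definition sigma_min :: "complex^'n^'n \<Rightarrow> real"
  where "sigma_min B = Min (singular_values B)"

text \<open>The first argument fixes the common dimension $k$ of the two subspaces. The angle does not
  depend on the orthonormal bases, see \<open>theta_max_col_span\<close> below.\<close>

definition theta_max :: "'k::finite itself \<Rightarrow> (complex^'n) set \<Rightarrow> (complex^'n) set \<Rightarrow> real"
  where "theta_max _ \<U> \<V> = (THE \<theta>. 0 \<le> \<theta> \<and> \<theta> \<le> pi / 2 \<and>
    (\<exists>(U :: complex^'k^'n) (V :: complex^'k^'n).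
      ctranspose U ** U = mat 1 \<and> ctranspose V ** V = mat 1 \<and>
      col_span U = \<U> \<and> col_span V = \<V> \<and> cos \<theta> = sigma_min (ctranspose V ** U)))"

section \<open>Well-definedness\<close>

lemma norm_matrix_vector_le: "norm (B *v x) \<le> spec_norm B * norm x"
  unfolding spec_norm_def by (rule onorm) simp

lemma spec_norm_nonneg: "0 \<le> spec_norm B"
  unfolding spec_norm_def by (rule onorm_pos_le) simp

lemma spec_norm_add: "spec_norm (B + C) \<le> spec_norm B + spec_norm C"
proof -
  have "(*v) (B + C) = (\<lambda>x. B *v x + C *v x)"
    by (auto simp: matrix_vector_mult_add_rdistrib)
  then show ?thesis
    unfolding spec_norm_def by (simp add: onorm_triangle)
qed

lemma spec_norm_minus: "spec_norm (- B) = spec_norm B"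
proof -
  have "(*v) (- B) = (\<lambda>x. - (B *v x))"
    by (auto simp: vec_eq_iff matrix_vector_mult_def sum_negf)
  then show ?thesis
    unfolding spec_norm_def by (simp add: onorm_neg)
qed

lemma spec_norm_le_norm:
  obtains K where "\<And>B :: complex^'n^'m. spec_norm B \<le> K * norm B"
proof -
  have "bilinear ((*v) :: complex^'n^'m \<Rightarrow> complex^'n \<Rightarrow> complex^'m)"
    unfolding bilinear_def
    by (auto intro!: linearI simp: vec_eq_iff matrix_vector_mult_def algebra_simps
        sum.distrib scaleR_sum_right)
  then have "bounded_bilinear ((*v) :: complex^'n^'m \<Rightarrow> complex^'n \<Rightarrow> complex^'m)"
    by (simp add: bilinear_conv_bounded_bilinear)
  then obtain K where K: "\<And>(B :: complex^'n^'m) x. norm (B *v x) \<le> norm B * norm x * K"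
    using bounded_bilinear.bounded by blast
  have "spec_norm B \<le> K * norm B" for B :: "complex^'n^'m"
    unfolding spec_norm_def by (rule onorm_le) (use K in \<open>simp add: mult.commute mult.left_commute\<close>)
  then show ?thesis
    using that by blast
qed

lemma norm_le_spec_norm:
  obtains K where "\<And>B :: complex^'n^'m. norm B \<le> K * spec_norm B"
proof -
  have "norm B \<le> (real CARD('m) * real CARD('n)) * spec_norm B" for B :: "complex^'n^'m"
  proof -
    have ent: "norm (B $ i $ j) \<le> spec_norm B" for i j
    proof -
      have "B $ i $ j = (B *v axis j 1) $ i"
        by (simp add: matrix_vector_mult_def axis_def if_distrib cong: if_cong)
      also have "norm \<dots> \<le> norm (B *v axis j 1)"
        by (rule Finite_Cartesian_Product.norm_nth_le)
      also have "\<dots> \<le> spec_norm B * norm (axis j 1 :: complex^'n)"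
        by (rule norm_matrix_vector_le)
      finally show ?thesis by simp
    qed
    have "norm B \<le> (\<Sum>i\<in>UNIV. norm (B $ i))"
      unfolding norm_vec_def by (rule L2_set_le_sum) simp
    also have "\<dots> \<le> (\<Sum>i\<in>UNIV. \<Sum>j\<in>UNIV. norm (B $ i $ j))"
      by (rule sum_mono, subst norm_vec_def, rule L2_set_le_sum) simp
    also have "\<dots> \<le> (\<Sum>i\<in>(UNIV :: 'm set). \<Sum>j\<in>(UNIV :: 'n set). spec_norm B)"
      by (intro sum_mono ent)
    finally show ?thesis by simp
  qed
  then show ?thesis using that by blast
qed

lemma continuous_on_spec_norm: "continuous_on S (spec_norm :: complex^'n^'m \<Rightarrow> real)"
proof -
  obtain K where K: "\<And>B :: complex^'n^'m. spec_norm B \<le> K * norm B"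
    using spec_norm_le_norm by blast
  define L where "L = \<bar>K\<bar>"
  have L: "spec_norm B \<le> L * norm B" for B :: "complex^'n^'m"
    by (rule order_trans[OF K mult_right_mono]) (auto simp: L_def)
  have le: "spec_norm B - spec_norm C \<le> L * norm (B - C)" for B C :: "complex^'n^'m"
    using spec_norm_add[of "B - C" C] L[of "B - C"] by simp
  have "\<bar>spec_norm B - spec_norm C\<bar> \<le> L * norm (B - C)" for B C :: "complex^'n^'m"
    using le[of B C] le[of C B] by (simp add: norm_minus_commute abs_le_iff)
  then have "L-lipschitz_on S (spec_norm :: complex^'n^'m \<Rightarrow> real)"
    by (intro lipschitz_onI) (auto simp: dist_norm L_def)
  then show ?thesis
    by (rule lipschitz_on_continuous_on)
qed

lemma sep_attained:
  fixes B :: "complex^'p^'p" and C :: "complex^'q^'q"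
  obtains Y :: "complex^'q^'p" where "spec_norm Y = 1" "spec_norm (B ** Y - Y ** C) = sep B C"
    and "\<And>Z :: complex^'q^'p. spec_norm Z = 1 \<Longrightarrow> sep B C \<le> spec_norm (B ** Z - Z ** C)"
proof -
  define S where "S = {Y :: complex^'q^'p. spec_norm Y = 1}"
  define f where "f = (\<lambda>Y :: complex^'q^'p. spec_norm (B ** Y - Y ** C))"
  obtain K where K: "\<And>Y :: complex^'q^'p. norm Y \<le> K * spec_norm Y"
    using norm_le_spec_norm by blast
  have "closed S"
    unfolding S_def
    using continuous_closed_preimage_constant[OF continuous_on_spec_norm closed_UNIV, of 1] by simp
  moreover have "bounded S"
    unfolding bounded_iff S_def using K by (metis mem_Collect_eq mult.right_neutral)
  ultimately have "compact S"
    by (simp add: compact_eq_bounded_closed)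
  have "S \<noteq> {}"
  proof -
    define Y :: "complex^'q^'p" where "Y = (\<chi> i j. 1)"
    have "Y \<noteq> 0" by (auto simp: Y_def vec_eq_iff)
    then have "spec_norm Y > 0"
      using K[of Y] spec_norm_nonneg[of Y] by (cases "spec_norm Y = 0") auto
    define c where "c = inverse (spec_norm Y)"
    have "(*v) (c *\<^sub>R Y) = (\<lambda>x. c *\<^sub>R (Y *v x))"
      by (auto simp: vec_eq_iff matrix_vector_mult_def scaleR_sum_right)
    then have "spec_norm (c *\<^sub>R Y) = \<bar>c\<bar> * spec_norm Y"
      unfolding spec_norm_def by (simp add: onorm_scaleR)
    then have "spec_norm (c *\<^sub>R Y) = 1"
      using \<open>spec_norm Y > 0\<close> by (simp add: c_def)
    then show ?thesis by (auto simp: S_def)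
  qed
  have lin: "bounded_linear (\<lambda>Y :: complex^'q^'p. B ** Y - Y ** C)"
    by (rule linear_conv_bounded_linear[THEN iffD1], rule linearI)
      (auto simp: vec_eq_iff matrix_matrix_mult_def algebra_simps sum.distrib scaleR_sum_right
        scaleR_diff_right)
  have "continuous_on S f"
    unfolding f_def
    by (rule continuous_on_compose2[OF continuous_on_spec_norm[of UNIV]])
      (auto intro: linear_continuous_on lin)
  then obtain Y where Y: "Y \<in> S" "\<And>Z. Z \<in> S \<Longrightarrow> f Y \<le> f Z"
    using continuous_attains_inf[OF \<open>compact S\<close> \<open>S \<noteq> {}\<close>] by blast
  have "sep B C = f Y"
    unfolding sep_def S_def[symmetric] f_def[symmetric]
    by (rule cInf_eq_minimum) (use Y in auto)
  then show ?thesis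
    using Y that[of Y] by (auto simp: S_def f_def)
qed

lemma ctranspose_mult: "ctranspose (B ** C) = ctranspose C ** ctranspose B"
  by (simp add: vec_eq_iff ctranspose_def matrix_matrix_mult_def mult.commute)

lemma ctranspose_ctranspose: "ctranspose (ctranspose B) = B"
  by (simp add: vec_eq_iff ctranspose_def)

lemma inner_matrix_vector: "inner (B *v x) y = inner x (ctranspose B *v y)"
proof -
  have "inner (B *v x) y = (\<Sum>i\<in>UNIV. \<Sum>j\<in>UNIV. inner (B $ i $ j * x $ j) (y $ i))"
    by (simp add: inner_vec_def matrix_vector_mult_def inner_sum_left)
  also have "\<dots> = (\<Sum>j\<in>UNIV. \<Sum>i\<in>UNIV. inner (x $ j) (cnj (B $ i $ j) * y $ i))"
    by (subst sum.swap) (simp add: inner_complex_def algebra_simps)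
  also have "\<dots> = inner x (ctranspose B *v y)"
    by (simp add: inner_vec_def matrix_vector_mult_def inner_sum_right ctranspose_def)
  finally show ?thesis .
qed

lemma norm_matrix_vector_square:
  "(norm (B *v x))\<^sup>2 = inner x ((ctranspose B ** B) *v x)"
  by (simp add: power2_norm_eq_inner inner_matrix_vector matrix_vector_mul_assoc)

lemma scalar_eq_scaleR: "complex_of_real c *s (v :: complex^'n) = c *\<^sub>R v"
  unfolding vec_eq_iff vector_smult_component vector_scaleR_component by (simp add: scaleR_conv_of_real)

lemma singular_value_norm:
  assumes "(ctranspose B ** B) *v v = complex_of_real (\<sigma>\<^sup>2) *s v" "0 \<le> \<sigma>"
  shows "norm (B *v v) = \<sigma> * norm v"
proof -
  have "(norm (B *v v))\<^sup>2 = (\<sigma> * norm v)\<^sup>2"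
    unfolding norm_matrix_vector_square assms(1) scalar_eq_scaleR
    by (simp add: power_mult_distrib power2_norm_eq_inner)
  then show ?thesis using assms(2) by simp
qed

lemma singular_values_nonempty: "singular_values B \<noteq> {}"
proof -
  have ne: "sphere 0 1 \<noteq> ({} :: (complex^'n) set)" by simp
  have "continuous_on (sphere 0 1) (\<lambda>x. norm (B *v x))"
    by (intro continuous_intros)
  then obtain v where v: "norm v = 1" and min: "\<And>x. norm x = 1 \<Longrightarrow> norm (B *v v) \<le> norm (B *v x)"
    using continuous_attains_inf[OF compact_sphere ne] by fastforce
  define m where "m = (norm (B *v v))\<^sup>2"
  define H where "H = ctranspose B ** B"
  have ge: "0 \<le> (norm (B *v x))\<^sup>2 - m * (norm x)\<^sup>2" for x
  proof (cases "x = 0")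
    case False
    have "norm (B *v v) \<le> norm (B *v ((1 / norm x) *\<^sub>R x))"
      by (rule min) (use False in simp)
    also have "B *v ((1 / norm x) *\<^sub>R x) = (1 / norm x) *\<^sub>R (B *v x)"
      by (rule linear_cmul) (simp add: bounded_linear.linear)
    finally have "norm (B *v v) * norm x \<le> norm (B *v x)"
      using False by (simp add: field_simps)
    then have "(norm (B *v v) * norm x)\<^sup>2 \<le> (norm (B *v x))\<^sup>2"
      by (rule power_mono) simp
    then show ?thesis by (simp add: m_def power_mult_distrib)
  qed simp
  define w where "w = H *v v - m *\<^sub>R v"
  define c where "c = (norm (B *v w))\<^sup>2 - m * (norm w)\<^sup>2"
  have quad: "0 \<le> 2 * t * (norm w)\<^sup>2 + t\<^sup>2 * c" for t
  proof -
    have e: "B *v (v + t *\<^sub>R w) = B *v v + t *\<^sub>R (B *v w)"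
      by (subst linear_add, simp add: bounded_linear.linear, subst linear_cmul)
        (simp_all add: bounded_linear.linear)
    have "0 \<le> (norm (B *v (v + t *\<^sub>R w)))\<^sup>2 - m * (norm (v + t *\<^sub>R w))\<^sup>2"
      by (rule ge)
    also have "\<dots> = (m - m * (norm v)\<^sup>2) + 2 * t * (inner (B *v v) (B *v w) - m * inner v w) + t\<^sup>2 * c"
      unfolding e c_def m_def power2_norm_eq_inner
      by (simp add: inner_add_left inner_add_right inner_commute algebra_simps power2_eq_square)
    also have "inner (B *v v) (B *v w) = inner (H *v v) w"
      by (metis H_def inner_commute inner_matrix_vector matrix_vector_mul_assoc)
    also have "inner (H *v v) w - m * inner v w = (norm w)\<^sup>2"
      by (simp add: w_def power2_norm_eq_inner inner_diff_left)
    finally show ?thesis using v by simp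
  qed
  have "w = 0"
  proof (rule ccontr)
    assume "w \<noteq> 0"
    define n where "n = (norm w)\<^sup>2"
    have n: "n > 0" using \<open>w \<noteq> 0\<close> by (simp add: n_def)
    define d where "d = \<bar>c\<bar> + 1"
    have d: "d > 0" "c \<le> d" by (auto simp: d_def)
    have "(- n / d)\<^sup>2 * c \<le> (- n / d)\<^sup>2 * d"
      by (rule mult_left_mono) (use d in auto)
    also have "\<dots> = n\<^sup>2 / d"
      using d by (simp add: power2_eq_square field_simps)
    finally have "0 \<le> 2 * (- n / d) * n + n\<^sup>2 / d"
      using quad[of "- n / d"] by (simp add: n_def)
    then have "n\<^sup>2 / d \<le> 0"
      by (simp add: power2_eq_square)
    then show False using n d by (simp add: field_simps)
  qed
  moreover have "v \<noteq> 0" using v by auto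
  ultimately have "norm (B *v v) \<in> singular_values B"
    unfolding singular_values_def scalar_eq_scaleR
    by (auto simp: w_def H_def m_def)
  then show ?thesis by blast
qed

lemma finite_singular_values: "finite (singular_values B)"
proof -
  define H where "H = ctranspose B ** B"
  obtain v where v: "\<And>\<sigma>. \<sigma> \<in> singular_values B \<Longrightarrow> v \<sigma> \<noteq> 0 \<and> H *v v \<sigma> = \<sigma>\<^sup>2 *\<^sub>R v \<sigma>"
  proof -
    have "\<forall>\<sigma>. \<exists>v. \<sigma> \<in> singular_values B \<longrightarrow> v \<noteq> 0 \<and> H *v v = \<sigma>\<^sup>2 *\<^sub>R v"
      unfolding singular_values_def scalar_eq_scaleR H_def by blast
    then show ?thesis using that by metis
  qed
  have sym: "inner (H *v x) y = inner x (H *v y)" for x y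
    unfolding H_def inner_matrix_vector by (simp add: ctranspose_mult ctranspose_ctranspose)
  have orth: "inner (v \<sigma>) (v \<tau>) = 0"
    if "\<sigma> \<in> singular_values B" "\<tau> \<in> singular_values B" "\<sigma> \<noteq> \<tau>" for \<sigma> \<tau>
  proof -
    have "\<sigma>\<^sup>2 * inner (v \<sigma>) (v \<tau>) = \<tau>\<^sup>2 * inner (v \<sigma>) (v \<tau>)"
      using sym[of "v \<sigma>" "v \<tau>"] v[OF that(1)] v[OF that(2)] by simp
    moreover have "\<sigma>\<^sup>2 \<noteq> \<tau>\<^sup>2"
      using that by (auto simp: singular_values_def)
    ultimately show ?thesis by simp
  qed
  have "inj_on v (singular_values B)"
    by (rule inj_onI) (metis inner_eq_zero_iff orth v)
  moreover have "finite (v ` singular_values B)"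
    by (rule pairwise_orthogonal_imp_finite) (auto simp: pairwise_def orthogonal_def intro!: orth)
  ultimately show ?thesis by (rule finite_imageD[rotated])
qed

lemma sigma_min_in_singular_values: "sigma_min B \<in> singular_values B"
  unfolding sigma_min_def by (intro Min_in finite_singular_values singular_values_nonempty)

lemma singular_values_mult_right:
  fixes B Q :: "complex^'n^'n"
  assumes "ctranspose Q ** Q = mat 1"
  shows "singular_values B \<subseteq> singular_values (B ** Q)"
proof
  have Q: "Q ** ctranspose Q = mat 1"
    using assms by (rule matrix_left_right_inverse[THEN iffD1])
  fix \<sigma> assume "\<sigma> \<in> singular_values B"
  then obtain v where v: "0 \<le> \<sigma>" "v \<noteq> 0" "(ctranspose B ** B) *v v = complex_of_real (\<sigma>\<^sup>2) *s v"
    by (auto simp: singular_values_def)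
  define u where "u = ctranspose Q *v v"
  have Qu: "Q *v u = v" by (simp add: u_def matrix_vector_mul_assoc Q)
  have "(ctranspose (B ** Q) ** (B ** Q)) *v u = ctranspose Q *v ((ctranspose B ** B) *v (Q *v u))"
    by (simp add: ctranspose_mult matrix_vector_mul_assoc matrix_mul_assoc)
  also have "\<dots> = complex_of_real (\<sigma>\<^sup>2) *s u"
    unfolding Qu v(3) by (simp only: u_def vec.scale)
  finally have "(ctranspose (B ** Q) ** (B ** Q)) *v u = complex_of_real (\<sigma>\<^sup>2) *s u" .
  moreover have "u \<noteq> 0" using Qu v(2) by auto
  ultimately show "\<sigma> \<in> singular_values (B ** Q)"
    using v(1) by (auto simp: singular_values_def)
qed

lemma sigma_min_unitary:
  fixes B P Q :: "complex^'n^'n"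
  assumes "ctranspose P ** P = mat 1" "ctranspose Q ** Q = mat 1"
  shows "sigma_min (P ** B ** Q) = sigma_min B"
proof -
  have Q: "Q ** ctranspose Q = mat 1"
    using assms(2) by (rule matrix_left_right_inverse[THEN iffD1])
  have "ctranspose (P ** B) ** (P ** B) = ctranspose B ** (ctranspose P ** P) ** B"
    by (simp add: ctranspose_mult matrix_mul_assoc)
  then have "singular_values (P ** B) = singular_values B"
    unfolding singular_values_def assms(1) by simp
  moreover have "singular_values (P ** B ** Q) = singular_values (P ** B)"
  proof
    have "P ** B ** Q ** ctranspose Q = P ** B"
      by (simp add: Q flip: matrix_mul_assoc)
    then show "singular_values (P ** B ** Q) \<subseteq> singular_values (P ** B)"
      using singular_values_mult_right[of "ctranspose Q" "P ** B ** Q"] Q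
      by (simp add: ctranspose_ctranspose)
  qed (rule singular_values_mult_right[OF assms(2)])
  ultimately show ?thesis by (simp add: sigma_min_def)
qed

lemma orthonormal_basis_change:
  assumes U: "ctranspose U ** U = mat 1" and U': "ctranspose U' ** U' = mat 1"
    and span: "col_span U = col_span U'"
  obtains Q where "U' = U ** Q" "ctranspose Q ** Q = mat 1"
proof -
  define P where "P = U ** ctranspose U"
  have PU: "P ** U = U"
    by (simp add: P_def U flip: matrix_mul_assoc)
  have base: "P *v column j U = column j U" for j
  proof -
    have "(P *v column j U) $ i = (P ** U) $ i $ j" for i
      by (simp add: matrix_matrix_mult_def matrix_vector_mult_def column_def)
    then show ?thesis unfolding PU by (simp add: vec_eq_iff column_def)
  qed
  have fix_P: "P *v x = x" if "x \<in> col_span U" for x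
    using that unfolding col_span_def
  proof (induction rule: vec.span_induct_alt)
    case base then show ?case by simp
  next
    case (step c x y)
    then show ?case using base
      by (auto simp: columns_def vec.add vec.scale)
  qed
  have PU': "P ** U' = U'"
  proof -
    have "column j U' \<in> col_span U'" for j
      unfolding col_span_def by (rule vec.span_base) (auto simp: columns_def)
    then have *: "P *v column j U' = column j U'" for j
      using fix_P span by blast
    then have "(P *v column j U') $ i = U' $ i $ j" for i j
      by (simp add: column_def)
    then show ?thesis
      by (simp add: vec_eq_iff matrix_matrix_mult_def matrix_vector_mult_def column_def)
  qed
  define Q where "Q = ctranspose U ** U'"
  have 1: "U' = U ** Q"
    using PU' by (simp add: Q_def P_def matrix_mul_assoc)
  have "ctranspose Q ** Q = ctranspose U' ** (P ** U')"
    by (simp add: Q_def P_def ctranspose_mult ctranspose_ctranspose matrix_mul_assoc)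
  then have "ctranspose Q ** Q = mat 1"
    by (simp add: PU' U')
  with 1 show ?thesis by (rule that)
qed

lemma sigma_min_le_1:
  fixes U V :: "complex^'k^'n"
  assumes U: "ctranspose U ** U = mat 1" and V: "ctranspose V ** V = mat 1"
  shows "sigma_min (ctranspose V ** U) \<le> 1"
proof -
  obtain v where v: "v \<noteq> 0"
    "norm ((ctranspose V ** U) *v v) = sigma_min (ctranspose V ** U) * norm v"
    using sigma_min_in_singular_values[of "ctranspose V ** U"] singular_value_norm
    unfolding singular_values_def by blast
  define y where "y = U *v v"
  define z where "z = ctranspose V *v y"
  have ny: "norm y = norm v"
    using norm_matrix_vector_square[of U v] U
    by (simp add: y_def flip: power2_norm_eq_inner)
  have "norm (V *v z) = norm z"
    using norm_matrix_vector_square[of V z] V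
    by (simp flip: power2_norm_eq_inner)
  then have "inner (V *v z) y \<le> norm z * norm y"
    using norm_cauchy_schwarz[of "V *v z" y] by simp
  moreover have "inner (V *v z) y = norm z * norm z"
    by (simp add: inner_matrix_vector z_def flip: power2_norm_eq_inner power2_eq_square)
  ultimately have "norm z \<le> norm y"
    using norm_ge_zero[of z] norm_ge_zero[of y]
    by (metis less_le mult_le_cancel_left_pos)
  moreover have "norm z = sigma_min (ctranspose V ** U) * norm v"
    using v(2) by (simp add: z_def y_def matrix_vector_mul_assoc)
  ultimately show ?thesis using v(1) ny by simp
qed

lemma theta_max_col_span:
  fixes U V :: "complex^'k^'n"
  assumes U: "ctranspose U ** U = mat 1" and V: "ctranspose V ** V = mat 1"
  shows "theta_max TYPE('k) (col_span U) (col_span V) = arccos (sigma_min (ctranspose V ** U))"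
proof -
  let ?\<sigma> = "sigma_min (ctranspose V ** U)"
  have range: "0 \<le> ?\<sigma>" "?\<sigma> \<le> 1"
    using sigma_min_in_singular_values[of "ctranspose V ** U"] sigma_min_le_1[OF U V]
    by (auto simp: singular_values_def)
  have indep: "sigma_min (ctranspose V' ** U') = ?\<sigma>"
    if U': "ctranspose U' ** U' = mat 1" "col_span U' = col_span U"
      and V': "ctranspose V' ** V' = mat 1" "col_span V' = col_span V"
    for U' V' :: "complex^'k^'n"
  proof -
    obtain Q where Q: "U' = U ** Q" "ctranspose Q ** Q = mat 1"
      using orthonormal_basis_change[OF U U'(1) U'(2)[symmetric]] .
    obtain P where P: "V' = V ** P" "ctranspose P ** P = mat 1"
      using orthonormal_basis_change[OF V V'(1) V'(2)[symmetric]] .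
    have "ctranspose V' ** U' = ctranspose P ** (ctranspose V ** U) ** Q"
      by (simp add: P Q ctranspose_mult matrix_mul_assoc)
    moreover have "ctranspose (ctranspose P) ** ctranspose P = mat 1"
      using P(2) unfolding ctranspose_ctranspose by (rule matrix_left_right_inverse[THEN iffD1])
    ultimately show ?thesis
      using Q(2) by (simp add: sigma_min_unitary)
  qed
  show ?thesis
    unfolding theta_max_def
  proof (rule the_equality)
    show "0 \<le> arccos ?\<sigma> \<and> arccos ?\<sigma> \<le> pi / 2 \<and>
      (\<exists>(U' :: complex^'k^'n) (V' :: complex^'k^'n).
        ctranspose U' ** U' = mat 1 \<and> ctranspose V' ** V' = mat 1 \<and>
        col_span U' = col_span U \<and> col_span V' = col_span V \<and>
        cos (arccos ?\<sigma>) = sigma_min (ctranspose V' ** U'))"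
      using U V range arccos_lbound[of ?\<sigma>] arccos_le_pi2[of ?\<sigma>] cos_arccos[of ?\<sigma>]
      by (intro conjI exI[of _ U] exI[of _ V]) auto
  next
    fix \<theta>
    assume \<theta>: "0 \<le> \<theta> \<and> \<theta> \<le> pi / 2 \<and>
      (\<exists>(U' :: complex^'k^'n) (V' :: complex^'k^'n).
        ctranspose U' ** U' = mat 1 \<and> ctranspose V' ** V' = mat 1 \<and>
        col_span U' = col_span U \<and> col_span V' = col_span V \<and>
        cos \<theta> = sigma_min (ctranspose V' ** U'))"
    then obtain U' V' :: "complex^'k^'n"
      where "ctranspose U' ** U' = mat 1" "ctranspose V' ** V' = mat 1"
        "col_span U' = col_span U" "col_span V' = col_span V"
        and cos: "cos \<theta> = sigma_min (ctranspose V' ** U')"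
      by (elim conjE exE)
    then have "cos \<theta> = ?\<sigma>"
      using indep[of U' V'] by simp
    moreover have "arccos (cos \<theta>) = \<theta>"
      using \<theta> pi_ge_zero by (intro arccos_cos) linarith+
    ultimately show "\<theta> = arccos ?\<sigma>"
      by simp
  qed
qed

end

theory Submission
  imports Defs "HOL-Complex_Analysis.Cauchy_Integral_Formula"
begin

text \<open>Everything reduces to one quadratic equation. Multiplying out the blocks, both invariant-pair
conditions on $X$ say the same thing, the Riccati equation
\[ A_{22} X - X A_{11} = X A_{12} X - \big(E_{21} + E_{22} X - X (E_{11} + E_{12} X)\big) =: F(X) \]
(\<open>right_invariant_pair_iff_riccati\<close>, \<open>left_invariant_pair_iff_riccati\<close>). Since $s > 0$, the Sylvester
operator on the left has an inverse $L$ of norm at most $1/s$ (\<open>sylvester_inverse\<close>), so the solutions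
are the fixed points of $\Phi = L \circ F$.

The bracket in $F$ is the product $[-X \; I]\, E\, [I; X]$, hence of norm at most
$\|E\| (1 + \|X\|^2)$. With $e = \|E\|$ and $a = \|A_{12}\|$ this gives
$s \|\Phi(X)\| \le e + (a + e) \|X\|^2$. The condition $4 e (e + a) < s^2$ says that
$s r = e + (a + e) r^2$ has two distinct real roots (one if $a + e = 0$); the smaller one is the bound
claimed for $\|X\|$.
The ball with this radius is mapped into itself, and Brouwer's theorem yields a solution.

Uniqueness among $\|X\| \le 2 e / s$ does not follow from a Lipschitz estimate: the derivative of
$\Phi$ can have norm larger than 1 on that ball. But for $r$ strictly between the roots the open ball
of radius $r$ is mapped into a strictly smaller one, and $\Phi$ is a polynomial map, so
$\Phi$ is a contraction for a holomorphically invariant metric. This is the Earle-Hamilton argument, in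
\<open>holomorphic_self_map_unique_fixed_point\<close>.

For the angles, let $V$ be an orthonormal basis of $\mathrm{span}\,[I; X]$, obtained as
$V = [I; X] S$ with $S^* (I + X^* X) S = I$. Then $V^* [I; 0] = S^*$ and $S S^* = (I + X^* X)^{-1}$, whose
smallest eigenvalue is $1 / (1 + \|X\|^2)$; this is $\cos^2 \theta_{\max}$. The left subspaces are treated
in the same way, with $- X^*$ in place of $X$ (\<open>tan_theta_max_eq_spec_norm\<close>).\<close>

section \<open>The spectral norm\<close>

lemma spec_norm_le:
  assumes "\<And>x. norm (B *v x) \<le> b * norm x"
  shows "spec_norm B \<le> b"
  unfolding spec_norm_def by (rule onorm_le) (rule assms)

lemma spec_norm_mult: "spec_norm (B ** C) \<le> spec_norm B * spec_norm C"
proof (rule spec_norm_le)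
  fix x
  have "norm ((B ** C) *v x) = norm (B *v (C *v x))"
    by (simp add: matrix_vector_mul_assoc)
  also have "\<dots> \<le> spec_norm B * norm (C *v x)"
    by (rule norm_matrix_vector_le)
  also have "\<dots> \<le> spec_norm B * (spec_norm C * norm x)"
    by (intro mult_left_mono norm_matrix_vector_le spec_norm_nonneg)
  finally show "norm ((B ** C) *v x) \<le> spec_norm B * spec_norm C * norm x"
    by simp
qed

lemma spec_norm_diff: "spec_norm (B - C) \<le> spec_norm B + spec_norm C"
  using spec_norm_add[of B "- C"] by (simp add: spec_norm_minus)

lemma scaleR_matrix_vector_mult: "(c *\<^sub>R B) *v x = c *\<^sub>R (B *v x)" for B :: "complex^'n^'m"
  by (simp add: vec_eq_iff matrix_vector_mult_def scaleR_sum_right)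

lemma spec_norm_scaleR: "spec_norm (c *\<^sub>R B) = \<bar>c\<bar> * spec_norm B"
proof -
  have "(*v) (c *\<^sub>R B) = (\<lambda>x. c *\<^sub>R (B *v x))"
    by (auto simp: scaleR_matrix_vector_mult)
  then show ?thesis
    unfolding spec_norm_def by (simp add: onorm_scaleR)
qed

lemma spec_norm_zero [simp]: "spec_norm 0 = 0"
  using spec_norm_scaleR[of 0 0] by simp

lemma spec_norm_mat_1 [simp]: "spec_norm (mat 1 :: complex^'n^'n) = 1"
proof -
  have "(*v) (mat 1 :: complex^'n^'n) = (\<lambda>x. x)"
    by auto
  then show ?thesis
    by (simp add: spec_norm_def onorm_id)
qed

lemma entry_le_spec_norm: "norm (B $ i $ j) \<le> spec_norm B"
proof -
  have "B $ i $ j = (B *v axis j 1) $ i"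
    by (simp add: matrix_vector_mult_def axis_def if_distrib cong: if_cong)
  also have "norm \<dots> \<le> norm (B *v axis j 1)"
    by (rule Finite_Cartesian_Product.norm_nth_le)
  also have "\<dots> \<le> spec_norm B * norm (axis j 1 :: complex^_)"
    by (rule norm_matrix_vector_le)
  finally show ?thesis by simp
qed

lemma spec_norm_eq_0_iff [simp]: "spec_norm B = 0 \<longleftrightarrow> B = 0"
proof
  assume "spec_norm B = 0"
  then have "norm (B $ i $ j) \<le> 0" for i j
    using entry_le_spec_norm[of B i j] by simp
  then show "B = 0"
    by (simp add: vec_eq_iff)
qed simp

lemma spec_norm_ctranspose_le: "spec_norm (ctranspose B) \<le> spec_norm B"
proof (rule spec_norm_le)
  fix x
  define y where "y = ctranspose B *v x"
  have "norm y * norm y = inner (B *v y) x"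
    unfolding inner_matrix_vector y_def[symmetric]
    by (simp flip: power2_eq_square power2_norm_eq_inner)
  also have "\<dots> \<le> norm (B *v y) * norm x"
    by (rule norm_cauchy_schwarz)
  also have "\<dots> \<le> (spec_norm B * norm y) * norm x"
    by (intro mult_right_mono norm_matrix_vector_le) simp
  finally have "norm y * norm y \<le> (spec_norm B * norm x) * norm y"
    by (simp add: mult_ac)
  then have "norm y \<le> spec_norm B * norm x"
    by (cases "norm y = 0") (auto simp: spec_norm_nonneg)
  then show "norm (ctranspose B *v x) \<le> spec_norm B * norm x"
    by (simp add: y_def)
qed

lemma spec_norm_ctranspose [simp]: "spec_norm (ctranspose B) = spec_norm B"
  using spec_norm_ctranspose_le[of B] spec_norm_ctranspose_le[of "ctranspose B"]
  by (simp add: ctranspose_ctranspose)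

lemma compact_spec_norm_ball: "compact {Y :: complex^'n^'m. spec_norm Y \<le> r}"
proof -
  obtain K where K: "\<And>Y :: complex^'n^'m. norm Y \<le> K * spec_norm Y"
    using norm_le_spec_norm by blast
  have "norm Y \<le> \<bar>K\<bar> * \<bar>r\<bar>" if "spec_norm Y \<le> r" for Y :: "complex^'n^'m"
  proof -
    have "norm Y \<le> \<bar>K\<bar> * spec_norm Y"
      using K[of Y] mult_right_mono[OF abs_ge_self spec_norm_nonneg, of K Y] by simp
    also have "\<dots> \<le> \<bar>K\<bar> * \<bar>r\<bar>"
      using that by (intro mult_left_mono) auto
    finally show ?thesis .
  qed
  then have "bounded {Y :: complex^'n^'m. spec_norm Y \<le> r}"
    unfolding bounded_iff by blast
  moreover have "closed {Y :: complex^'n^'m. spec_norm Y \<le> r}"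
    by (intro closed_Collect_le continuous_on_spec_norm continuous_intros)
  ultimately show ?thesis
    by (simp add: compact_eq_bounded_closed)
qed

lemma convex_spec_norm_ball: "convex {Y :: complex^'n^'m. spec_norm Y \<le> r}"
proof (rule convexI)
  fix Y Z :: "complex^'n^'m" and u v :: real
  assume *: "Y \<in> {Y. spec_norm Y \<le> r}" "Z \<in> {Y. spec_norm Y \<le> r}" "0 \<le> u" "0 \<le> v" "u + v = 1"
  have "spec_norm (u *\<^sub>R Y + v *\<^sub>R Z) \<le> u * spec_norm Y + v * spec_norm Z"
    using spec_norm_add[of "u *\<^sub>R Y" "v *\<^sub>R Z"] * by (simp add: spec_norm_scaleR)
  also have "\<dots> \<le> r"
    using * by (intro convex_bound_le) auto
  finally show "u *\<^sub>R Y + v *\<^sub>R Z \<in> {Y. spec_norm Y \<le> r}" by simp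
qed

section \<open>Matrix algebra\<close>

lemma ctranspose_mat_1 [simp]: "ctranspose (mat 1) = mat 1"
  by (simp add: vec_eq_iff ctranspose_def mat_def)

lemma ctranspose_zero [simp]: "ctranspose 0 = 0"
  by (simp add: vec_eq_iff ctranspose_def)

lemma ctranspose_add: "ctranspose (B + C) = ctranspose B + ctranspose C"
  by (simp add: vec_eq_iff ctranspose_def)

lemma ctranspose_minus: "ctranspose (- B) = - ctranspose B"
  by (simp add: vec_eq_iff ctranspose_def)

lemma ctranspose_diff: "ctranspose (B - C) = ctranspose B - ctranspose C"
  by (simp add: vec_eq_iff ctranspose_def)

lemma ctranspose_scaleR: "ctranspose (c *\<^sub>R B) = c *\<^sub>R ctranspose B"
  by (simp add: vec_eq_iff ctranspose_def complex_eq_iff)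

lemma ctranspose_eq_iff: "ctranspose B = ctranspose C \<longleftrightarrow> B = C"
  by (metis ctranspose_ctranspose)

lemma scaleR_matrix_mult: "(c *\<^sub>R B) ** C = c *\<^sub>R (B ** C)" for B :: "complex^'n^'m"
  by (simp add: vec_eq_iff matrix_matrix_mult_def scaleR_sum_right)

lemma matrix_mult_scaleR: "B ** (c *\<^sub>R C) = c *\<^sub>R (B ** C)" for B :: "complex^'n^'m"
  by (simp add: vec_eq_iff matrix_matrix_mult_def scaleR_sum_right)

lemma continuous_on_matrix_mult [continuous_intros]:
  fixes f :: "'a::topological_space \<Rightarrow> complex^'n^'m" and g :: "'a \<Rightarrow> complex^'p^'n"
  assumes "continuous_on S f" "continuous_on S g"
  shows "continuous_on S (\<lambda>x. f x ** g x)"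
  unfolding matrix_matrix_mult_def
  by (intro continuous_intros continuous_on_vec_lambda assms)

lemma matrix_minus_left: "(- B) ** C = - (B ** C)" for B :: "complex^'n^'m"
  by (simp add: vec_eq_iff matrix_matrix_mult_def sum_negf)

lemma matrix_minus_right: "B ** (- C) = - (B ** C)" for B :: "complex^'n^'m"
  by (simp add: vec_eq_iff matrix_matrix_mult_def sum_negf)

lemma matrix_diff_left: "(B - B') ** C = B ** C - B' ** C" for B :: "complex^'n^'m"
  by (simp add: vec_eq_iff matrix_matrix_mult_def sum_subtractf left_diff_distrib)

lemma matrix_diff_right: "B ** (C - C') = B ** C - B ** C'" for B :: "complex^'n^'m"
  by (simp add: vec_eq_iff matrix_matrix_mult_def sum_subtractf right_diff_distrib)

lemma mat_mult_entry: "(mat c ** Y) $ i $ j = c * Y $ i $ j" for Y :: "complex^'n^'m"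
  by (simp add: matrix_matrix_mult_def mat_def if_distrib if_distribR cong: if_cong)

lemma mult_mat_entry: "(Y ** mat c) $ i $ j = c * Y $ i $ j" for Y :: "complex^'n^'m"
  by (simp add: matrix_matrix_mult_def mat_def if_distrib if_distribR mult.commute cong: if_cong)

lemma mat_commutes: "mat c ** Y = Y ** mat c" for Y :: "complex^'n^'m"
  by (simp add: vec_eq_iff mat_mult_entry mult_mat_entry)

lemma matrix_add_left: "(B + B') ** C = B ** C + B' ** C" for B :: "complex^'n^'m"
  by (simp add: vec_eq_iff matrix_matrix_mult_def sum.distrib distrib_right)

section \<open>Orthonormal bases\<close>

text \<open>Up to a positive factor, $W^* W$ has a Hermitian square root. For small $c$ the matrix
$B = I - c\, W^* W$ has norm at most 1, and then $Y \mapsto \frac12 (B + Y^2)$ maps the Hermitian matrices of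
norm at most 1 into themselves. A fixed point $Y$, which exists by Brouwer's theorem, satisfies
$(I - Y)^2 = I - B = c\, W^* W$. This replaces the spectral theorem.\<close>

lemma scaled_hermitian_sqrt:
  fixes W :: "complex^'k^'n"
  obtains R :: "complex^'k^'k" and c :: real
  where "0 < c" "ctranspose R = R" "R ** R = c *\<^sub>R (ctranspose W ** W)"
proof -
  define H where "H = ctranspose W ** W"
  \<comment> \<open>$\|B v\|^2 = \|v\|^2 - 2c \|W v\|^2 + c^2 \|H v\|^2$ and $\|H v\| \le \|W\| \|W v\|$, so any $c > 0$ with
    $c \|W\|^2 \le 2$ makes the norm of $B$ at most 1.\<close>
  define c where "c = 1 / ((spec_norm W)\<^sup>2 + 1)"
  define B where "B = mat 1 - c *\<^sub>R H"
  have c: "0 < c" "c * (spec_norm W)\<^sup>2 \<le> 1"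
    using add_nonneg_pos[OF zero_le_power2[of "spec_norm W"] zero_less_one]
    by (simp_all add: c_def)
  have herm: "ctranspose B = B"
    by (simp add: B_def H_def ctranspose_diff ctranspose_scaleR ctranspose_mult ctranspose_ctranspose)
  have "spec_norm B \<le> 1"
  proof (rule spec_norm_le)
    fix v
    have Bv: "B *v v = v - c *\<^sub>R (H *v v)"
      by (simp add: B_def matrix_vector_mult_diff_rdistrib scaleR_matrix_vector_mult)
    have "norm (H *v v) \<le> spec_norm W * norm (W *v v)"
      using norm_matrix_vector_le[of "ctranspose W" "W *v v"]
      by (simp add: H_def matrix_vector_mul_assoc)
    then have "(norm (H *v v))\<^sup>2 \<le> (spec_norm W * norm (W *v v))\<^sup>2"
      by (rule power_mono) simp
    then have "c * (norm (H *v v))\<^sup>2 \<le> c * (spec_norm W)\<^sup>2 * (norm (W *v v))\<^sup>2"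
      using c by (simp add: power_mult_distrib)
    also have "\<dots> \<le> 1 * (norm (W *v v))\<^sup>2"
      using c by (intro mult_right_mono) auto
    finally have 1: "c * (norm (H *v v))\<^sup>2 \<le> (norm (W *v v))\<^sup>2" by simp
    have "(norm (B *v v))\<^sup>2 = (norm v)\<^sup>2 - 2 * c * (norm (W *v v))\<^sup>2 + c * (c * (norm (H *v v))\<^sup>2)"
      unfolding Bv norm_matrix_vector_square[of W v] H_def[symmetric]
      unfolding power2_norm_eq_inner
      by (simp add: inner_diff_left inner_diff_right inner_commute[of "H *v v" v] algebra_simps)
    also have "\<dots> \<le> (norm v)\<^sup>2 - 2 * c * (norm (W *v v))\<^sup>2 + c * (norm (W *v v))\<^sup>2"
      using 1 c by (intro add_left_mono mult_left_mono) auto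
    also have "\<dots> \<le> (norm v)\<^sup>2"
      using c by simp
    finally have "norm (B *v v) \<le> norm v"
      by (rule power2_le_imp_le) simp
    then show "norm (B *v v) \<le> 1 * norm v"
      by simp
  qed
  define S where "S = {Y :: complex^'k^'k. spec_norm Y \<le> 1} \<inter> {Y. ctranspose Y = Y}"
  define f where "f = (\<lambda>Y :: complex^'k^'k. (1 / 2) *\<^sub>R (B + Y ** Y))"
  have ct: "continuous_on UNIV (ctranspose :: complex^'k^'k \<Rightarrow> _)"
    unfolding ctranspose_def by (intro continuous_intros continuous_on_vec_lambda)
  obtain Y where Y: "Y \<in> S" "f Y = Y"
  proof (rule brouwer[of S f])
    show "compact S"
      unfolding S_def
      by (intro compact_Int_closed compact_spec_norm_ball closed_Collect_eq ct continuous_intros)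
    have "convex {Y :: complex^'k^'k. ctranspose Y = Y}"
      by (rule convexI) (simp add: ctranspose_add ctranspose_scaleR)
    then show "convex S"
      unfolding S_def by (intro convex_Int convex_spec_norm_ball)
    have "0 \<in> S"
      by (simp add: S_def)
    then show "S \<noteq> {}" by blast
    show "continuous_on S f"
      unfolding f_def by (intro continuous_intros)
    show "f \<in> S \<rightarrow> S"
    proof
      fix Y assume "Y \<in> S"
      then have Y: "spec_norm Y \<le> 1" "ctranspose Y = Y"
        by (auto simp: S_def)
      have "spec_norm (Y ** Y) \<le> 1 * 1"
        using spec_norm_mult[of Y Y] mult_mono[OF Y(1) Y(1)] by (simp add: spec_norm_nonneg)
      then have "spec_norm (B + Y ** Y) \<le> 2"
        using spec_norm_add[of B "Y ** Y"] \<open>spec_norm B \<le> 1\<close> by simp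
      then show "f Y \<in> S"
        by (simp add: S_def f_def spec_norm_scaleR ctranspose_scaleR ctranspose_add
            ctranspose_mult Y herm)
    qed
  qed
  define R where "R = mat 1 - Y"
  have "R ** R = mat 1 - (Y + Y) + Y ** Y"
    by (simp add: R_def matrix_diff_left matrix_diff_right)
  also have "Y + Y = 2 *\<^sub>R f Y"
    using Y(2) by (simp add: scaleR_2)
  also have "2 *\<^sub>R f Y = B + Y ** Y"
    by (simp add: f_def)
  finally have "R ** R = c *\<^sub>R H"
    by (simp add: B_def)
  moreover have "ctranspose R = R"
    using Y(1) by (simp add: R_def S_def ctranspose_diff)
  ultimately show ?thesis
    using that[of c R] c by (simp add: H_def)
qed

lemma col_span_eq_range: "col_span B = range ((*v) B)"
proof
  show "col_span B \<subseteq> range ((*v) B)"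
    unfolding col_span_def
  proof (rule vec.span_minimal)
    show "columns B \<subseteq> range ((*v) B)"
    proof
      fix y assume "y \<in> columns B"
      then obtain j where "y = column j B"
        by (auto simp: columns_def)
      then have "y = B *v axis j 1"
        by (simp add: vec_eq_iff matrix_vector_mult_def column_def axis_def if_distrib cong: if_cong)
      then show "y \<in> range ((*v) B)" by blast
    qed
    show "vec.subspace (range ((*v) B))"
      unfolding vec.subspace_def by (auto simp: image_iff simp flip: vec.add vec.scale) (metis vec.zero)+
  qed
  show "range ((*v) B) \<subseteq> col_span B"
    unfolding col_span_def using matrix_vector_mult_in_columnspace_gen by blast
qed

lemma invariant_col_span:
  assumes "B ** X0 = X0 ** M0"
  shows "(*v) B ` col_span X0 \<subseteq> col_span X0"
proof -
  have "B *v (X0 *v x) = X0 *v (M0 *v x)" for x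
    by (simp add: matrix_vector_mul_assoc assms)
  then show ?thesis
    unfolding col_span_eq_range by auto
qed

lemma col_span_mult_right:
  fixes W :: "complex^'k^'n" and S :: "complex^'k^'k"
  assumes "S ** T = mat 1"
  shows "col_span (W ** S) = col_span W"
proof -
  have "W *v x = (W ** S) *v (T *v x)" for x
    by (simp add: matrix_vector_mul_assoc assms flip: matrix_mul_assoc)
  then show ?thesis
    unfolding col_span_eq_range by (auto simp flip: matrix_vector_mul_assoc)
qed

lemma rank_left_invertible:
  fixes B :: "complex^'k^'n"
  assumes "C ** B = mat 1"
  shows "rank B = CARD('k)"
proof -
  have "vec.span (rows B) = UNIV"
    using assms matrix_left_invertible_span_rows_gen by blast
  then show ?thesis
    unfolding row_rank_def_gen by (metis vec.dim_span vec.dim_UNIV card_cart_basis vec_dim_card)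
qed

text \<open>The columns of $W$ are orthonormalised by $S = \sqrt c\, R^{-1}$ with $R^2 = c\, W^* W$; the left inverse
$C$ makes $W$, and therefore $R$, injective.\<close>

lemma orthonormal_columns:
  fixes W :: "complex^'k^'n"
  assumes "C ** W = mat 1"
  obtains S T :: "complex^'k^'k"
  where "ctranspose (W ** S) ** (W ** S) = mat 1" "S ** T = mat 1"
proof -
  obtain R :: "complex^'k^'k" and c :: real
    where R: "0 < c" "ctranspose R = R" "R ** R = c *\<^sub>R (ctranspose W ** W)"
    using scaled_hermitian_sqrt .
  have "x = 0" if "R *v x = 0" for x
  proof -
    have "(norm (R *v x))\<^sup>2 = c * (norm (W *v x))\<^sup>2"
      unfolding norm_matrix_vector_square R(2,3) by (simp add: scaleR_matrix_vector_mult)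
    then have "W *v x = 0"
      using that R(1) by simp
    then have "(C ** W) *v x = 0"
      by (simp flip: matrix_vector_mul_assoc)
    then show "x = 0"
      by (simp add: assms)
  qed
  then obtain Q where Q: "Q ** R = mat 1"
    using matrix_left_invertible_ker by blast
  then have Q': "R ** Q = mat 1"
    by (rule matrix_left_right_inverse[THEN iffD1])
  have "ctranspose Q ** R = ctranspose (R ** Q)"
    by (simp add: ctranspose_mult R)
  then have Q'': "ctranspose Q ** R = mat 1"
    by (simp add: Q')
  define S where "S = sqrt c *\<^sub>R Q"
  have "ctranspose (W ** S) ** (W ** S) = ctranspose Q ** (c *\<^sub>R (ctranspose W ** W)) ** Q"
    using R(1) by (simp add: S_def ctranspose_mult ctranspose_scaleR scaleR_matrix_mult
        matrix_mult_scaleR matrix_mul_assoc)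
  also have "\<dots> = (ctranspose Q ** R) ** (R ** Q)"
    by (simp add: matrix_mul_assoc flip: R(3))
  finally have "ctranspose (W ** S) ** (W ** S) = mat 1"
    by (simp add: Q' Q'')
  moreover have "S ** ((1 / sqrt c) *\<^sub>R R) = mat 1"
    using R(1) by (simp add: S_def scaleR_matrix_mult matrix_mult_scaleR Q)
  ultimately show ?thesis by (rule that)
qed

section \<open>Canonical angles\<close>

text \<open>A unit vector $v$ at which $\|Z v\|$ is maximal is an eigenvector: with $u = Z^* Z v$ and $z = \|Z\|$,
expanding the square gives $\|u - z^2 v\|^2 = \|u\|^2 - z^4 \le 0$.\<close>

lemma spec_norm_singular_vector:
  fixes Z :: "complex^'k^'n"
  obtains v where "v \<noteq> 0" "(ctranspose Z ** Z) *v v = (spec_norm Z)\<^sup>2 *\<^sub>R v"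
proof -
  have ne: "sphere 0 1 \<noteq> ({} :: (complex^'k) set)" by simp
  have "continuous_on (sphere 0 1) (\<lambda>x. norm (Z *v x))"
    by (intro continuous_intros)
  then obtain v where v: "norm v = 1" and max: "\<And>x. norm x = 1 \<Longrightarrow> norm (Z *v x) \<le> norm (Z *v v)"
    using continuous_attains_sup[OF compact_sphere ne] by fastforce
  define z where "z = spec_norm Z"
  have "spec_norm Z \<le> norm (Z *v v)"
  proof (rule spec_norm_le)
    fix x :: "complex^'k"
    show "norm (Z *v x) \<le> norm (Z *v v) * norm x"
    proof (cases "x = 0")
      case False
      have "norm (Z *v ((1 / norm x) *\<^sub>R x)) \<le> norm (Z *v v)"
        by (rule max) (use False in simp)
      also have "Z *v ((1 / norm x) *\<^sub>R x) = (1 / norm x) *\<^sub>R (Z *v x)"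
        by (rule linear_cmul) (simp add: bounded_linear.linear)
      finally show ?thesis
        using False by (simp add: field_simps)
    qed simp
  qed
  then have Zv: "norm (Z *v v) = z"
    using norm_matrix_vector_le[of Z v] v by (simp add: z_def)
  define u where "u = (ctranspose Z ** Z) *v v"
  have uv: "inner u v = z\<^sup>2"
    using norm_matrix_vector_square[of Z v] by (simp add: u_def Zv inner_commute)
  have "norm u \<le> z * z"
    using norm_matrix_vector_le[of "ctranspose Z" "Z *v v"]
    by (simp add: u_def matrix_vector_mul_assoc Zv z_def[symmetric])
  then have "(norm u)\<^sup>2 \<le> (z\<^sup>2)\<^sup>2"
    by (intro power_mono) (auto simp: power2_eq_square)
  moreover have "(norm (u - z\<^sup>2 *\<^sub>R v))\<^sup>2 = (norm u)\<^sup>2 - 2 * z\<^sup>2 * inner u v + (z\<^sup>2)\<^sup>2 * (norm v)\<^sup>2"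
    unfolding power2_norm_eq_inner
    by (simp add: inner_diff_left inner_diff_right inner_commute algebra_simps power2_eq_square)
  ultimately have "(norm (u - z\<^sup>2 *\<^sub>R v))\<^sup>2 \<le> 0"
    by (simp add: uv v power2_eq_square)
  then have "u = z\<^sup>2 *\<^sub>R v" by simp
  moreover have "v \<noteq> 0" using v by auto
  ultimately show ?thesis
    using that by (simp add: u_def z_def)
qed

text \<open>The hypotheses describe $\mathrm{span}\,W$ as the graph of $Z$ over $\mathrm{span}\,U$ in orthonormal
coordinates, in a form that covers both $[I; X]$ over $[I; 0]$ and $[-X^*; I]$ over $[0; I]$.
With $H = W^* W$ and $S^* H S = I$, the singular values to be minimised are those of $S^*$, and
$S S^* = H^{-1}$; each $\sigma$ among them satisfies $\sigma^2 (1 + \|Z\|^2) \ge 1$, with equality at the top singular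
vector of $Z$.\<close>

lemma tan_theta_max_eq_spec_norm:
  fixes U W :: "complex^'k^'n" and Z :: "complex^'k^'p"
  assumes UU: "ctranspose U ** U = mat 1" and UW: "ctranspose U ** W = mat 1"
    and WW: "ctranspose W ** W = mat 1 + ctranspose Z ** Z"
  shows "tan (theta_max TYPE('k) (col_span U) (col_span W)) = spec_norm Z"
proof -
  obtain S T :: "complex^'k^'k"
    where S: "ctranspose (W ** S) ** (W ** S) = mat 1" "S ** T = mat 1"
    using orthonormal_columns[OF UW] .
  define H where "H = ctranspose W ** W"
  define z where "z = spec_norm Z"
  have Hv: "H *v v = v + (ctranspose Z ** Z) *v v" for v
    by (simp add: H_def WW matrix_vector_mult_add_rdistrib)
  have "(ctranspose S ** H) ** S = mat 1"
    using S(1) by (simp add: H_def ctranspose_mult matrix_mul_assoc)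
  then have "S ** (ctranspose S ** H) = mat 1"
    by (rule matrix_left_right_inverse[THEN iffD1])
  then have SSH: "(S ** ctranspose S) ** H = mat 1"
    by (simp add: matrix_mul_assoc)
  then have HSS: "H ** (S ** ctranspose S) = mat 1"
    by (rule matrix_left_right_inverse[THEN iffD1])
  have "ctranspose (W ** S) ** U = ctranspose S ** ctranspose (ctranspose U ** W)"
    by (simp add: ctranspose_mult ctranspose_ctranspose matrix_mul_assoc)
  then have VU: "ctranspose (W ** S) ** U = ctranspose S"
    by (simp add: UW)
  have pos: "1 + z\<^sup>2 > 0"
    by (simp add: add_pos_nonneg)
  have "sigma_min (ctranspose S) = 1 / sqrt (1 + z\<^sup>2)"
    unfolding sigma_min_def
  proof (rule Min_eqI)
    show "finite (singular_values (ctranspose S))"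
      by (rule finite_singular_values)
    fix \<sigma> assume "\<sigma> \<in> singular_values (ctranspose S)"
    then obtain v where v: "0 \<le> \<sigma>" "v \<noteq> 0" "(S ** ctranspose S) *v v = \<sigma>\<^sup>2 *\<^sub>R v"
      unfolding singular_values_def ctranspose_ctranspose scalar_eq_scaleR by blast
    have "v = H *v ((S ** ctranspose S) *v v)"
      unfolding matrix_vector_mul_assoc HSS by simp
    also have "\<dots> = \<sigma>\<^sup>2 *\<^sub>R (H *v v)"
      unfolding v(3) by (rule linear_cmul) (simp add: bounded_linear.linear)
    finally have "inner v v = inner v (\<sigma>\<^sup>2 *\<^sub>R (H *v v))"
      by simp
    also have "\<dots> = \<sigma>\<^sup>2 * ((norm v)\<^sup>2 + (norm (Z *v v))\<^sup>2)"
      by (simp add: Hv inner_add_right norm_matrix_vector_square power2_norm_eq_inner[of v])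
    also have "\<dots> \<le> \<sigma>\<^sup>2 * ((norm v)\<^sup>2 + (z * norm v)\<^sup>2)"
      unfolding z_def by (intro mult_left_mono add_left_mono power_mono norm_matrix_vector_le) auto
    also have "\<dots> = \<sigma>\<^sup>2 * (1 + z\<^sup>2) * (norm v)\<^sup>2"
      by (simp add: power_mult_distrib algebra_simps)
    finally have "1 * (norm v)\<^sup>2 \<le> \<sigma>\<^sup>2 * (1 + z\<^sup>2) * (norm v)\<^sup>2"
      by (simp add: power2_norm_eq_inner)
    then have "1 \<le> \<sigma>\<^sup>2 * (1 + z\<^sup>2)"
      using v(2) by (subst (asm) mult_le_cancel_right_pos) auto
    then have "1 \<le> (\<sigma> * sqrt (1 + z\<^sup>2))\<^sup>2"
      using pos by (simp add: power_mult_distrib)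
    then have "1 \<le> \<sigma> * sqrt (1 + z\<^sup>2)"
      using v(1) pos by (intro power2_le_imp_le[of 1]) auto
    then show "1 / sqrt (1 + z\<^sup>2) \<le> \<sigma>"
      using pos by (simp add: field_simps)
  next
    obtain v where v: "v \<noteq> 0" "(ctranspose Z ** Z) *v v = z\<^sup>2 *\<^sub>R v"
      using spec_norm_singular_vector[of Z] unfolding z_def .
    have "v = (S ** ctranspose S) *v (H *v v)"
      unfolding matrix_vector_mul_assoc SSH by simp
    also have "H *v v = (1 + z\<^sup>2) *\<^sub>R v"
      by (simp add: Hv v scaleR_left_distrib)
    also have "(S ** ctranspose S) *v ((1 + z\<^sup>2) *\<^sub>R v) = (1 + z\<^sup>2) *\<^sub>R ((S ** ctranspose S) *v v)"
      by (rule linear_cmul) (simp add: bounded_linear.linear)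
    finally have "(1 / (1 + z\<^sup>2)) *\<^sub>R v = (S ** ctranspose S) *v v"
      using pos by (metis divide_inverse inverse_eq_divide mult_1 scaleR_scaleR left_inverse
          scaleR_one less_irrefl)
    moreover have "(1 / sqrt (1 + z\<^sup>2))\<^sup>2 = 1 / (1 + z\<^sup>2)"
      using pos by (simp add: power_divide)
    ultimately show "1 / sqrt (1 + z\<^sup>2) \<in> singular_values (ctranspose S)"
      unfolding singular_values_def ctranspose_ctranspose scalar_eq_scaleR
      using v(1) pos by (auto intro!: exI[of _ v])
  qed
  then have "theta_max TYPE('k) (col_span U) (col_span (W ** S)) = arccos (cos (arctan z))"
    using theta_max_col_span[OF UU S(1)] by (simp add: VU cos_arctan)
  also have "\<dots> = arctan z"
  proof (rule arccos_cos)
    show "0 \<le> arctan z"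
      by (simp add: z_def spec_norm_nonneg)
    show "arctan z \<le> pi"
      using arctan_ubound[of z] pi_gt_zero by linarith
  qed
  finally show ?thesis
    by (simp add: col_span_mult_right[OF S(2)] tan_arctan z_def)
qed

section \<open>Holomorphic self-maps of a ball of matrices\<close>

text \<open>Holomorphy of a map between matrix spaces is expressed through its effect on matrix-valued functions
of one complex variable. In this form it is closed under composition by definition, and Cauchy's
inequality in one variable applies to it directly.\<close>

definition entrywise_holomorphic :: "(complex^'m^'k \<Rightarrow> complex^'q^'p) \<Rightarrow> bool"
  where "entrywise_holomorphic f \<longleftrightarrow>
    (\<forall>S z. open S \<longrightarrow> (\<forall>i j. (\<lambda>\<zeta>. z \<zeta> $ i $ j) holomorphic_on S) \<longrightarrow>
      (\<forall>i j. (\<lambda>\<zeta>. f (z \<zeta>) $ i $ j) holomorphic_on S))"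

lemma entrywise_holomorphicI:
  fixes f :: "complex^'m^'k \<Rightarrow> complex^'q^'p"
  assumes "\<And>S z i j. open S \<Longrightarrow> (\<And>i j. (\<lambda>\<zeta>. z \<zeta> $ i $ j) holomorphic_on S) \<Longrightarrow>
    (\<lambda>\<zeta>. f (z \<zeta>) $ i $ j) holomorphic_on S"
  shows "entrywise_holomorphic f"
  unfolding entrywise_holomorphic_def
proof (intro allI impI)
  fix S and z :: "complex \<Rightarrow> complex^'m^'k" and i j
  assume "open S" and z: "\<forall>i j. (\<lambda>\<zeta>. z \<zeta> $ i $ j) holomorphic_on S"
  show "(\<lambda>\<zeta>. f (z \<zeta>) $ i $ j) holomorphic_on S"
    by (rule assms[OF \<open>open S\<close>]) (rule z[THEN spec, THEN spec])
qed

lemma entrywise_holomorphicD: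
  assumes "entrywise_holomorphic f" "open S" "\<And>i j. (\<lambda>\<zeta>. z \<zeta> $ i $ j) holomorphic_on S"
  shows "(\<lambda>\<zeta>. f (z \<zeta>) $ i $ j) holomorphic_on S"
proof -
  have "\<forall>i j. (\<lambda>\<zeta>. z \<zeta> $ i $ j) holomorphic_on S"
    using assms(3) by (intro allI)
  then have "\<forall>i j. (\<lambda>\<zeta>. f (z \<zeta>) $ i $ j) holomorphic_on S"
    by (rule assms(1)[unfolded entrywise_holomorphic_def, THEN spec, THEN spec, THEN mp, THEN mp, OF assms(2)])
  then show ?thesis
    by (elim allE)
qed

lemma entrywise_holomorphic_id: "entrywise_holomorphic (\<lambda>Z. Z)"
  unfolding entrywise_holomorphic_def by (intro allI impI) (elim allE)

lemma entrywise_holomorphic_const: "entrywise_holomorphic (\<lambda>Z. C)"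
  unfolding entrywise_holomorphic_def by (intro allI impI holomorphic_on_const)

lemma entrywise_holomorphic_add:
  fixes f g :: "complex^'m^'k \<Rightarrow> complex^'q^'p"
  assumes "entrywise_holomorphic f" "entrywise_holomorphic g"
  shows "entrywise_holomorphic (\<lambda>Z. f Z + g Z)"
proof (rule entrywise_holomorphicI)
  fix S and z :: "complex \<Rightarrow> complex^'m^'k" and i j
  assume z: "open S" "\<And>i j. (\<lambda>\<zeta>. z \<zeta> $ i $ j) holomorphic_on S"
  show "(\<lambda>\<zeta>. (f (z \<zeta>) + g (z \<zeta>)) $ i $ j) holomorphic_on S"
    unfolding vector_add_component
    by (rule holomorphic_on_add) (rule entrywise_holomorphicD[OF assms(1) z] entrywise_holomorphicD[OF assms(2) z])+
qed

lemma entrywise_holomorphic_diff: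
  fixes f g :: "complex^'m^'k \<Rightarrow> complex^'q^'p"
  assumes "entrywise_holomorphic f" "entrywise_holomorphic g"
  shows "entrywise_holomorphic (\<lambda>Z. f Z - g Z)"
proof (rule entrywise_holomorphicI)
  fix S and z :: "complex \<Rightarrow> complex^'m^'k" and i j
  assume z: "open S" "\<And>i j. (\<lambda>\<zeta>. z \<zeta> $ i $ j) holomorphic_on S"
  show "(\<lambda>\<zeta>. (f (z \<zeta>) - g (z \<zeta>)) $ i $ j) holomorphic_on S"
    unfolding vector_minus_component
    by (rule holomorphic_on_diff) (rule entrywise_holomorphicD[OF assms(1) z] entrywise_holomorphicD[OF assms(2) z])+
qed

lemma entrywise_holomorphic_mult:
  fixes f :: "complex^'m^'k \<Rightarrow> complex^'q^'p" and g :: "complex^'m^'k \<Rightarrow> complex^'s^'q"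
  assumes "entrywise_holomorphic f" "entrywise_holomorphic g"
  shows "entrywise_holomorphic (\<lambda>Z. f Z ** g Z)"
proof (rule entrywise_holomorphicI)
  fix S and z :: "complex \<Rightarrow> complex^'m^'k" and i j
  assume z: "open S" "\<And>i j. (\<lambda>\<zeta>. z \<zeta> $ i $ j) holomorphic_on S"
  show "(\<lambda>\<zeta>. (f (z \<zeta>) ** g (z \<zeta>)) $ i $ j) holomorphic_on S"
    unfolding matrix_matrix_mult_def vec_lambda_beta
    by (rule holomorphic_on_sum, rule holomorphic_on_mult)
      (rule entrywise_holomorphicD[OF assms(1) z] entrywise_holomorphicD[OF assms(2) z])+
qed

lemma entrywise_holomorphic_linear:
  fixes L :: "complex^'q^'p \<Rightarrow> complex^'s^'r" and f :: "complex^'m^'k \<Rightarrow> complex^'q^'p"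
  assumes lin: "linear L" and hom: "\<And>c Y. L (mat c ** Y) = mat c ** L Y"
    and f: "entrywise_holomorphic f"
  shows "entrywise_holomorphic (\<lambda>Z. L (f Z))"
proof -
  define u :: "'p \<Rightarrow> 'q \<Rightarrow> complex^'q^'p" where "u = (\<lambda>k l. \<chi> a b. if a = k \<and> b = l then 1 else 0)"
  have expand: "Y = (\<Sum>k\<in>UNIV. \<Sum>l\<in>UNIV. mat (Y $ k $ l) ** u k l)" for Y
  proof -
    have "(\<Sum>k\<in>UNIV. \<Sum>l\<in>UNIV. Y $ k $ l * (if a = k \<and> b = l then 1 else 0)) = Y $ a $ b" for a b
    proof -
      have "(\<Sum>k\<in>UNIV. \<Sum>l\<in>UNIV. Y $ k $ l * (if a = k \<and> b = l then 1 else 0))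
          = (\<Sum>k\<in>UNIV. if a = k then Y $ k $ b else 0)"
        by (rule sum.cong) (auto simp: if_distrib cong: if_cong)
      then show ?thesis by simp
    qed
    then show ?thesis
      by (simp add: vec_eq_iff mat_mult_entry u_def)
  qed
  have expand_L: "L Y = (\<Sum>k\<in>UNIV. \<Sum>l\<in>UNIV. mat (Y $ k $ l) ** L (u k l))" for Y
    by (subst expand) (simp add: linear_sum[OF lin] hom)
  define K where "K = (\<lambda>i j k l. L (u k l) $ i $ j)"
  have entry: "L Y $ i $ j = (\<Sum>k\<in>UNIV. \<Sum>l\<in>UNIV. Y $ k $ l * K i j k l)" for Y i j
    by (subst expand_L) (simp add: mat_mult_entry K_def)
  show ?thesis
  proof (rule entrywise_holomorphicI)
    fix S and z :: "complex \<Rightarrow> complex^'m^'k" and i j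
    assume z: "open S" "\<And>i j. (\<lambda>\<zeta>. z \<zeta> $ i $ j) holomorphic_on S"
    show "(\<lambda>\<zeta>. L (f (z \<zeta>)) $ i $ j) holomorphic_on S"
      unfolding entry
      by (rule holomorphic_on_sum, rule holomorphic_on_sum, rule holomorphic_on_mult)
        (rule entrywise_holomorphicD[OF f z] holomorphic_on_const)+
  qed
qed

text \<open>Restricting to real parameters turns the entrywise complex derivatives into one derivative with
values in the real normed space of matrices, to which the chain rule for $\Phi$ applies.\<close>

lemma entrywise_vector_derivative:
  fixes z :: "complex \<Rightarrow> complex^'m^'k"
  assumes "\<And>i j. (\<lambda>\<zeta>. z \<zeta> $ i $ j) holomorphic_on UNIV"
  shows "((\<lambda>t. z (complex_of_real t)) has_vector_derivative
    (\<chi> i j. deriv (\<lambda>\<zeta>. z \<zeta> $ i $ j) (complex_of_real t))) (at t within S)"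
  unfolding has_vector_derivative_def
proof (subst has_derivative_componentwise_within, rule ballI)
  fix b :: "complex^'m^'k" assume "b \<in> Basis"
  then obtain i c where b: "b = axis i c" "c \<in> Basis"
    by (auto simp: Basis_vec_def)
  then obtain j d where c: "c = axis j d" "d \<in> Basis"
    by (auto simp: Basis_vec_def)
  define D where "D = deriv (\<lambda>\<zeta>. z \<zeta> $ i $ j) (complex_of_real t)"
  have "((\<lambda>\<zeta>. z \<zeta> $ i $ j) has_field_derivative D) (at (complex_of_real t))"
    unfolding D_def by (rule holomorphic_derivI[OF assms]) auto
  then have "((\<lambda>t. z (complex_of_real t) $ i $ j) has_vector_derivative D) (at t within S)"
    by (rule has_vector_derivative_real_field)
  then have "((\<lambda>t. z (complex_of_real t) $ i $ j \<bullet> d) has_derivative (\<lambda>x. (x *\<^sub>R D) \<bullet> d)) (at t within S)"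
    unfolding has_vector_derivative_def by (rule has_derivative_inner_left)
  then show "((\<lambda>t. z (complex_of_real t) \<bullet> b) has_derivative
      (\<lambda>x. (x *\<^sub>R (\<chi> i j. deriv (\<lambda>\<zeta>. z \<zeta> $ i $ j) (complex_of_real t))) \<bullet> b)) (at t within S)"
    by (simp add: b c inner_axis D_def)
qed

text \<open>Let $z_n = \Phi^n \circ z_0$, where $z_0$ parametrises the line through $X$ and $Y$ with $z_0(0) = X$ and
$z_0(1) = Y$. It is shown that $z_n' \to 0$ geometrically on $[0, 1]$; as the end points are fixed,
this forces $X = Y$. To bound $z_n'(s)$, expand $\Phi$ slightly about each point of the orbit of $z_0(s)$: put
$w_0 = z_0$ and $w_{n+1} = z_{n+1}(s) + (1 + \delta) (\Phi \circ w_n - z_{n+1}(s))$. Since $\Phi$ maps the ball of radius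
$t$ into one of radius $q < t$, the $w_n$ still stay in the ball of radius $t$ near $s$, so by Cauchy's
inequality $w_n'(s)$ is bounded uniformly in $n$. But $w_n(s) = z_n(s)$, so by the chain rule
$w_n'(s) = (1 + \delta)^n z_n'(s)$.\<close>

lemma holomorphic_self_map_unique_fixed_point:
  fixes \<Phi> :: "complex^'m^'k \<Rightarrow> complex^'m^'k"
  assumes hol: "entrywise_holomorphic \<Phi>"
    and diff: "\<And>Z. \<Phi> differentiable (at Z)"
    and q: "q < t"
    and into: "\<And>Z. spec_norm Z < t \<Longrightarrow> spec_norm (\<Phi> Z) \<le> q"
    and X: "\<Phi> X = X" "spec_norm X < t" and Y: "\<Phi> Y = Y" "spec_norm Y < t"
  shows "X = Y"
proof -
  define \<rho> where "\<rho> = max (spec_norm X) (spec_norm Y)"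
  have \<rho>: "\<rho> < t" "0 \<le> \<rho>"
    using X Y spec_norm_nonneg[of X] by (auto simp: \<rho>_def le_max_iff_disj)
  then have "0 < t" by simp
  \<comment> \<open>Points of the two balls are at distance at most $2t$, and $q + 2t\delta < t$: the expanded maps
    keep the ball of radius $t$ invariant.\<close>
  define \<delta> where "\<delta> = (t - q) / (4 * t)"
  have \<delta>: "\<delta> > 0" "q + \<delta> * (2 * t) < t"
    using q \<open>0 < t\<close> by (auto simp: \<delta>_def field_simps)
  \<comment> \<open>Discs of radius $\eta$ about parameters in $[0,1]$ are mapped by $z_0$ into the ball of radius $t$.
    The summand 1 covers the case $X = Y$.\<close>
  define \<eta> where "\<eta> = (t - \<rho>) / (2 * (spec_norm (Y - X) + 1))"
  have \<eta>: "0 < \<eta>"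
    using \<rho> spec_norm_nonneg[of "Y - X"] by (auto simp: \<eta>_def intro!: divide_pos_pos)
  have \<eta>': "\<eta> * spec_norm (Y - X) < t - \<rho>"
  proof -
    have "\<eta> * spec_norm (Y - X) \<le> \<eta> * (spec_norm (Y - X) + 1)"
      using \<eta> by simp
    also have "\<dots> = (t - \<rho>) / 2"
      using spec_norm_nonneg[of "Y - X"] by (simp add: \<eta>_def field_simps)
    finally show ?thesis using \<rho> by simp
  qed
  define z where "z = rec_nat (\<lambda>\<zeta>. \<chi> i j. X $ i $ j + \<zeta> * (Y - X) $ i $ j) (\<lambda>n w \<zeta>. \<Phi> (w \<zeta>))"
  have z0: "z 0 = (\<lambda>\<zeta>. \<chi> i j. X $ i $ j + \<zeta> * (Y - X) $ i $ j)"
    and zS: "\<And>n. z (Suc n) = (\<lambda>\<zeta>. \<Phi> (z n \<zeta>))"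
    by (simp_all add: z_def)
  have z_hol: "(\<lambda>\<zeta>. z n \<zeta> $ i $ j) holomorphic_on UNIV" for n i j
  proof (induction n arbitrary: i j)
    case 0
    show ?case by (simp add: z0) (intro holomorphic_intros)
  next
    case (Suc n)
    then show ?case
      using hol unfolding entrywise_holomorphic_def zS by (metis open_UNIV)
  qed
  define z' where "z' = (\<lambda>n s. \<chi> i j. deriv (\<lambda>\<zeta>. z n \<zeta> $ i $ j) (complex_of_real s))"
  have z_deriv: "((\<lambda>s. z n (complex_of_real s)) has_vector_derivative z' n s) (at s within S)" for n s S
    unfolding z'_def by (rule entrywise_vector_derivative[OF z_hol])
  have z0_real: "z 0 (complex_of_real s) = (1 - s) *\<^sub>R X + s *\<^sub>R Y" for s
    by (simp add: z0 vec_eq_iff complex_eq_iff algebra_simps)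
  have z_fix: "z n 0 = X" "z n 1 = Y" for n
    by (induction n) (simp_all add: zS X Y, simp_all add: z0 vec_eq_iff)
  have bound: "norm (z' n s $ i $ j) \<le> (t / \<eta>) / (1 + \<delta>) ^ n" if s: "s \<in> {0..1}" for n s i j
  proof -
    have z0_le: "spec_norm (z 0 (complex_of_real s)) \<le> \<rho>"
      using convex_spec_norm_ball[of \<rho>, unfolded convex_alt, rule_format, of X Y s] s
      by (simp add: z0_real \<rho>_def)
    have z_le: "spec_norm (z n (complex_of_real s)) < t" for n
    proof (induction n)
      case 0 then show ?case using z0_le \<rho> by simp
    next
      case (Suc n)
      then show ?case using into[OF Suc] q by (simp add: zS)
    qed
    define p where "p = (\<lambda>n. z n (complex_of_real s))"
    define w where "w = rec_nat (z 0) (\<lambda>n u \<zeta>. p (Suc n) + (1 + \<delta>) *\<^sub>R (\<Phi> (u \<zeta>) - p (Suc n)))"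
    have w0: "w 0 = z 0"
      and wS: "\<And>n. w (Suc n) = (\<lambda>\<zeta>. p (Suc n) + (1 + \<delta>) *\<^sub>R (\<Phi> (w n \<zeta>) - p (Suc n)))"
      by (simp_all add: w_def)
    have w_hol: "(\<lambda>\<zeta>. w n \<zeta> $ i $ j) holomorphic_on UNIV" for n i j
    proof (induction n arbitrary: i j)
      case 0 then show ?case by (simp add: w0 z_hol)
    next
      case (Suc n)
      then have "(\<lambda>\<zeta>. \<Phi> (w n \<zeta>) $ i $ j) holomorphic_on UNIV" for i j
        using hol unfolding entrywise_holomorphic_def by (metis open_UNIV)
      then show ?case
        unfolding wS vector_add_component vector_scaleR_component vector_minus_component
          scaleR_conv_of_real[where 'a = complex]
        by (intro holomorphic_intros)
    qed
    define w' where "w' = (\<lambda>n. \<chi> i j. deriv (\<lambda>\<zeta>. w n \<zeta> $ i $ j) (complex_of_real s))"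
    have w_deriv: "((\<lambda>s. w n (complex_of_real s)) has_vector_derivative w' n) (at s)" for n
      unfolding w'_def by (rule entrywise_vector_derivative[OF w_hol])
    have w_centre: "w n (complex_of_real s) = p n" for n
      by (induction n) (simp_all add: w0 wS p_def zS)
    have w'_eq: "w' n = (1 + \<delta>) ^ n *\<^sub>R z' n s" for n
    proof (induction n)
      case 0
      then show ?case by (simp add: w'_def z'_def w0)
    next
      case (Suc n)
      obtain D where D: "(\<Phi> has_derivative D) (at (p n))"
        using diff[of "p n"] by (auto simp: differentiable_def)
      have chain: "((\<lambda>r. \<Phi> (u (complex_of_real r))) has_vector_derivative D u') (at s)"
        if "((\<lambda>r. u (complex_of_real r)) has_vector_derivative u') (at s)"
          "u (complex_of_real s) = p n" for u u'
        using vector_derivative_diff_chain_within[OF that(1), of \<Phi> D] D that(2)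
        by (simp add: o_def has_derivative_at_withinI)
      have "((\<lambda>r. z (Suc n) (complex_of_real r)) has_vector_derivative D (z' n s)) (at s)"
        unfolding zS by (rule chain[OF z_deriv]) (simp add: p_def)
      then have z'S: "z' (Suc n) s = D (z' n s)"
        using z_deriv[of "Suc n" s UNIV] vector_derivative_unique_at by blast
      have "((\<lambda>r. \<Phi> (w n (complex_of_real r))) has_vector_derivative D (w' n)) (at s)"
        by (rule chain[OF w_deriv w_centre])
      then have "((\<lambda>r. w (Suc n) (complex_of_real r)) has_vector_derivative (1 + \<delta>) *\<^sub>R D (w' n)) (at s)"
        unfolding wS by (auto intro!: derivative_eq_intros)
      then have "w' (Suc n) = (1 + \<delta>) *\<^sub>R D (w' n)"
        using w_deriv[of "Suc n"] vector_derivative_unique_at by blast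
      also have "D (w' n) = (1 + \<delta>) ^ n *\<^sub>R D (z' n s)"
        unfolding Suc.IH by (rule linear_cmul[OF has_derivative_linear[OF D]])
      finally show ?case by (simp add: z'S)
    qed
    have w_le: "spec_norm (w n \<zeta>) < t" if "norm (complex_of_real s - \<zeta>) = \<eta>" for n \<zeta>
    proof (induction n)
      case 0
      define c where "c = \<zeta> - complex_of_real s"
      have c: "norm c = \<eta>"
        using that by (simp add: c_def norm_minus_commute)
      define V where "V = (\<chi> i j. c * (Y - X) $ i $ j)"
      have "w 0 \<zeta> = z 0 (complex_of_real s) + V"
        by (simp add: w0 z0 V_def c_def vec_eq_iff algebra_simps)
      moreover have "spec_norm V \<le> \<eta> * spec_norm (Y - X)"
      proof (rule spec_norm_le)
        fix x
        have "V *v x = c *s ((Y - X) *v x)"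
          by (simp add: V_def vec_eq_iff matrix_vector_mult_def sum_distrib_left mult.assoc)
        then have "norm (V *v x) = \<eta> * norm ((Y - X) *v x)"
          using c \<eta> by (simp add: norm_mult norm_vec_def L2_set_right_distrib)
        then show "norm (V *v x) \<le> \<eta> * spec_norm (Y - X) * norm x"
          using norm_matrix_vector_le[of "Y - X" x] \<eta> by simp
      qed
      ultimately show ?case
        using spec_norm_add[of "z 0 (complex_of_real s)" V] z0_le \<eta>' by simp
    next
      case (Suc n)
      have "w (Suc n) \<zeta> = \<Phi> (w n \<zeta>) + \<delta> *\<^sub>R (\<Phi> (w n \<zeta>) - p (Suc n))"
        by (simp add: wS algebra_simps)
      then have "spec_norm (w (Suc n) \<zeta>)
          \<le> spec_norm (\<Phi> (w n \<zeta>)) + \<delta> * spec_norm (\<Phi> (w n \<zeta>) - p (Suc n))"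
        using spec_norm_add[of "\<Phi> (w n \<zeta>)" "\<delta> *\<^sub>R (\<Phi> (w n \<zeta>) - p (Suc n))"] \<delta>
        by (simp add: spec_norm_scaleR)
      also have "\<dots> \<le> q + \<delta> * (2 * t)"
      proof (intro add_mono mult_left_mono)
        show 1: "spec_norm (\<Phi> (w n \<zeta>)) \<le> q"
          by (rule into[OF Suc])
        show "spec_norm (\<Phi> (w n \<zeta>) - p (Suc n)) \<le> 2 * t"
          using spec_norm_diff[of "\<Phi> (w n \<zeta>)" "p (Suc n)"] 1 q z_le[of "Suc n"]
          by (simp add: p_def)
      qed (use \<delta> in simp)
      finally show ?case using \<delta> by simp
    qed
    have "norm ((deriv ^^ 1) (\<lambda>\<zeta>. w n \<zeta> $ i $ j) (complex_of_real s)) \<le> fact 1 * t / \<eta> ^ 1"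
    proof (rule Cauchy_inequality)
      show "continuous_on (cball (complex_of_real s) \<eta>) (\<lambda>\<zeta>. w n \<zeta> $ i $ j)"
        by (rule holomorphic_on_imp_continuous_on[OF holomorphic_on_subset[OF w_hol]]) simp
      show "(\<lambda>\<zeta>. w n \<zeta> $ i $ j) holomorphic_on ball (complex_of_real s) \<eta>"
        by (rule holomorphic_on_subset[OF w_hol]) simp
      show "norm (w n \<zeta> $ i $ j) \<le> t" if "norm (complex_of_real s - \<zeta>) = \<eta>" for \<zeta>
        using w_le[OF that, of n] entry_le_spec_norm[of "w n \<zeta>" i j] by simp
    qed (rule \<eta>)
    then have "norm (w' n $ i $ j) \<le> t / \<eta>"
      by (simp add: w'_def)
    moreover have "norm (w' n $ i $ j) = (1 + \<delta>) ^ n * norm (z' n s $ i $ j)"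
      using \<delta> by (simp add: w'_eq)
    ultimately show ?thesis
      using \<delta> by (subst pos_le_divide_eq) (simp_all add: mult.commute)
  qed
  have "Y $ i $ j - X $ i $ j = 0" for i j
  proof -
    have le: "norm (Y $ i $ j - X $ i $ j) \<le> (t / \<eta>) / (1 + \<delta>) ^ n" for n
    proof -
      have "((\<lambda>s. z n (complex_of_real s) $ i $ j) has_derivative (\<lambda>x. x *\<^sub>R (z' n s $ i $ j)))
          (at s within {0..1})" for s
      proof -
        have "bounded_linear (\<lambda>V :: complex^'m^'k. V $ i $ j)"
          using bounded_linear_compose[OF bounded_linear_vec_nth bounded_linear_vec_nth] .
        from bounded_linear.has_vector_derivative[OF this z_deriv[of n s "{0..1}"]]
        show ?thesis by (simp add: has_vector_derivative_def)
      qed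
      then have "norm (z n (complex_of_real 1) $ i $ j - z n (complex_of_real 0) $ i $ j)
          \<le> ((t / \<eta>) / (1 + \<delta>) ^ n) * norm (1 - 0 :: real)"
      proof (rule differentiable_bound[OF convex_real_interval(5)])
        fix s :: real assume s: "s \<in> {0..1}"
        show "onorm (\<lambda>x. x *\<^sub>R (z' n s $ i $ j)) \<le> (t / \<eta>) / (1 + \<delta>) ^ n"
          by (rule onorm_le) (simp only: norm_scaleR mult.commute[of "\<bar>_\<bar>"] real_norm_def
              mult_right_mono[OF bound[OF s]] abs_ge_zero)
      qed auto
      then show ?thesis by (simp add: z_fix)
    qed
    have "(\<lambda>n. (t / \<eta>) / (1 + \<delta>) ^ n) \<longlonglongrightarrow> 0"
      using \<delta> by (intro LIMSEQ_divide_realpow_zero) simp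
    then have "norm (Y $ i $ j - X $ i $ j) \<le> 0"
      by (rule tendsto_lowerbound) (use le in auto)
    then show ?thesis by simp
  qed
  then show "X = Y"
    by (simp add: vec_eq_iff)
qed

lemma bounded_bilinear_matrix_mult:
  "bounded_bilinear ((**) :: complex^'n^'m \<Rightarrow> complex^'p^'n \<Rightarrow> complex^'p^'m)"
  unfolding bilinear_conv_bounded_bilinear[symmetric] bilinear_def
  by (auto intro!: linearI
      simp: matrix_add_ldistrib matrix_add_left scaleR_matrix_mult matrix_mult_scaleR)

lemma differentiable_matrix_mult:
  fixes f :: "'a::real_normed_vector \<Rightarrow> complex^'n^'m" and g :: "'a \<Rightarrow> complex^'p^'n"
  assumes "f differentiable (at x within S)" "g differentiable (at x within S)"
  shows "(\<lambda>x. f x ** g x) differentiable (at x within S)"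
  using assms bounded_bilinear.FDERIV[OF bounded_bilinear_matrix_mult]
  unfolding differentiable_def by blast

section \<open>Block matrices and the Riccati equation\<close>

lemma sum_UNIV_sum:
  fixes f :: "'a::finite + 'b::finite \<Rightarrow> 'c::comm_monoid_add"
  shows "sum f UNIV = (\<Sum>a\<in>UNIV. f (Inl a)) + (\<Sum>b\<in>UNIV. f (Inr b))"
  by (subst UNIV_Plus_UNIV[symmetric], subst sum.Plus) simp_all

lemma all_sum: "(\<forall>i. P i) \<longleftrightarrow> (\<forall>a. P (Inl a)) \<and> (\<forall>b. P (Inr b))"
  by (metis sum.exhaust)

lemma four_block_mult_two_block:
  fixes P :: "complex^'m^'m" and Q :: "complex^'k^'m"
  shows "four_block P Q R S ** two_block X Y = two_block (P ** X + Q ** Y) (R ** X + S ** Y)"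
  by (simp add: vec_eq_iff all_sum four_block_def two_block_def matrix_matrix_mult_def sum_UNIV_sum)

lemma two_block_mult:
  fixes X :: "complex^'q^'m" and Y :: "complex^'q^'k"
  shows "two_block X Y ** M = two_block (X ** M) (Y ** M)"
  by (simp add: vec_eq_iff all_sum two_block_def matrix_matrix_mult_def)

lemma ctranspose_two_block_mult:
  fixes P :: "complex^'p^'m" and Q :: "complex^'p^'k" and X :: "complex^'q^'m" and Y :: "complex^'q^'k"
  shows "ctranspose (two_block P Q) ** two_block X Y = ctranspose P ** X + ctranspose Q ** Y"
  by (simp add: vec_eq_iff two_block_def ctranspose_def matrix_matrix_mult_def sum_UNIV_sum)

lemma ctranspose_four_block:
  "ctranspose (four_block P Q R S) =
    four_block (ctranspose P) (ctranspose R) (ctranspose Q) (ctranspose S)"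
  by (simp add: vec_eq_iff all_sum four_block_def ctranspose_def)

lemma four_block_add:
  fixes P :: "complex^'m^'m" and Q :: "complex^'k^'m"
  shows "four_block P Q R S + four_block P' Q' R' S' = four_block (P + P') (Q + Q') (R + R') (S + S')"
  by (simp add: vec_eq_iff all_sum four_block_def)

lemma two_block_eq_iff: "two_block X Y = two_block X' Y' \<longleftrightarrow> X = X' \<and> Y = Y'"
  by (auto simp: vec_eq_iff all_sum two_block_def)

text \<open>The first block row of the identity $B [I; X] = [I; X] M$ determines $M = P + Q X$; the second row is
the Riccati equation.\<close>

lemma right_invariant_pair_iff_riccati:
  fixes P :: "complex^'m^'m" and S :: "complex^'k^'k" and X :: "complex^'m^'k"
  shows "right_invariant_pair (four_block P Q R S) (two_block (mat 1) X) (P + Q ** X) \<longleftrightarrow>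
    R + S ** X = X ** (P + Q ** X)"
proof -
  have "ctranspose (two_block (mat 1) (0 :: complex^'m^'k)) ** two_block (mat 1) X = mat 1"
    by (simp add: ctranspose_two_block_mult)
  then have "rank (two_block (mat 1) X :: complex^'m^('m + 'k)) = CARD('m)"
    by (rule rank_left_invertible)
  then show ?thesis
    by (simp add: right_invariant_pair_def four_block_mult_two_block two_block_mult two_block_eq_iff)
qed

text \<open>Here the block $I$ determines $N = S - X Q$, and the other block is $R - X P = - N X$, a rearrangement of
the same Riccati equation.\<close>

lemma left_invariant_pair_iff_riccati:
  fixes P :: "complex^'m^'m" and S :: "complex^'k^'k" and X :: "complex^'m^'k"
  shows "left_invariant_pair (four_block P Q R S) (two_block (- ctranspose X) (mat 1)) (S - X ** Q) \<longleftrightarrow>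
    R + S ** X = X ** (P + Q ** X)"
proof -
  let ?Y = "two_block (- ctranspose X) (mat 1) :: complex^'k^('m + 'k)"
  let ?N = "S - X ** Q"
  have "ctranspose (two_block 0 (mat 1) :: complex^'k^('m + 'k)) ** ?Y = mat 1"
    by (simp add: ctranspose_two_block_mult)
  then have rank: "rank ?Y = CARD('k)"
    by (rule rank_left_invertible)
  have "ctranspose ?Y ** four_block P Q R S = ?N ** ctranspose ?Y \<longleftrightarrow>
      ctranspose (four_block P Q R S) ** ?Y = ?Y ** ctranspose ?N"
    by (subst ctranspose_eq_iff[symmetric]) (simp add: ctranspose_mult ctranspose_ctranspose)
  also have "\<dots> \<longleftrightarrow> ctranspose R - ctranspose P ** ctranspose X = - (ctranspose X ** ctranspose ?N)"
    by (auto simp: ctranspose_four_block four_block_mult_two_block two_block_mult two_block_eq_iff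
        ctranspose_diff ctranspose_mult matrix_minus_left matrix_minus_right)
  also have "\<dots> \<longleftrightarrow> ctranspose (R - X ** P) = ctranspose (- (?N ** X))"
    by (simp add: ctranspose_diff ctranspose_mult ctranspose_minus)
  also have "\<dots> \<longleftrightarrow> R + S ** X = X ** (P + Q ** X)"
    unfolding ctranspose_eq_iff
    by (simp add: matrix_diff_left matrix_add_ldistrib matrix_mul_assoc algebra_simps)
  finally show ?thesis
    using rank by (simp add: left_invariant_pair_def)
qed

lemma spec_norm_two_block_le:
  fixes P :: "complex^'q^'m" and Q :: "complex^'q^'k"
  shows "spec_norm (two_block P Q) \<le> sqrt ((spec_norm P)\<^sup>2 + (spec_norm Q)\<^sup>2)"
proof (rule spec_norm_le)
  fix u
  have "(norm (two_block P Q *v u))\<^sup>2 = (norm (P *v u))\<^sup>2 + (norm (Q *v u))\<^sup>2"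
    unfolding norm_matrix_vector_square ctranspose_two_block_mult
    by (simp add: matrix_vector_mult_add_rdistrib inner_add_right)
  also have "\<dots> \<le> (spec_norm P * norm u)\<^sup>2 + (spec_norm Q * norm u)\<^sup>2"
    by (intro add_mono power_mono norm_matrix_vector_le norm_ge_zero)
  also have "\<dots> = (sqrt ((spec_norm P)\<^sup>2 + (spec_norm Q)\<^sup>2) * norm u)\<^sup>2"
    by (simp add: power_mult_distrib algebra_simps)
  finally show "norm (two_block P Q *v u) \<le> sqrt ((spec_norm P)\<^sup>2 + (spec_norm Q)\<^sup>2) * norm u"
    by (rule power2_le_imp_le) simp
qed

text \<open>The left-hand side is $[-X \; I]\, E\, [I; X]$. Estimating the product as a whole, instead of its four terms, is
what leads to a smallness condition with $s$ itself in place of $s - \|E_{11}\| - \|E_{22}\|$.\<close>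

lemma spec_norm_riccati_perturbation_le:
  fixes E11 :: "complex^'m^'m" and E22 :: "complex^'k^'k" and X :: "complex^'m^'k"
  shows "spec_norm (E21 + E22 ** X - X ** (E11 + E12 ** X)) \<le>
    spec_norm (four_block E11 E12 E21 E22) * (1 + (spec_norm X)\<^sup>2)"
proof -
  let ?E = "four_block E11 E12 E21 E22"
  let ?V = "two_block (mat 1) X :: complex^'m^('m + 'k)"
  let ?U = "two_block (- ctranspose X) (mat 1) :: complex^'k^('m + 'k)"
  let ?r = "sqrt (1 + (spec_norm X)\<^sup>2)"
  have "E21 + E22 ** X - X ** (E11 + E12 ** X) = ctranspose ?U ** (?E ** ?V)"
    by (simp add: four_block_mult_two_block ctranspose_two_block_mult ctranspose_minus
        ctranspose_ctranspose matrix_minus_left)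
  also have "spec_norm \<dots> \<le> spec_norm ?U * (spec_norm ?E * spec_norm ?V)"
    using spec_norm_mult[of "ctranspose ?U" "?E ** ?V"]
      mult_left_mono[OF spec_norm_mult[of ?E ?V] spec_norm_nonneg[of ?U]]
    by simp
  also have "\<dots> \<le> ?r * (spec_norm ?E * ?r)"
    using spec_norm_two_block_le[of "- ctranspose X" "mat 1 :: complex^'k^'k"]
      spec_norm_two_block_le[of "mat 1 :: complex^'m^'m" X]
    by (intro mult_mono mult_left_mono mult_nonneg_nonneg)
      (simp_all add: spec_norm_minus spec_norm_nonneg add.commute)
  also have "\<dots> = spec_norm ?E * (1 + (spec_norm X)\<^sup>2)"
    by (simp add: mult.left_commute)
  finally show ?thesis .
qed

section \<open>The Sylvester operator\<close>

lemma sep_mult_le: "sep B C * spec_norm Y \<le> spec_norm (B ** Y - Y ** C)"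
proof (cases "Y = 0")
  case False
  define c where "c = 1 / spec_norm Y"
  have pos: "spec_norm Y > 0"
    using False by (metis less_le spec_norm_eq_0_iff spec_norm_nonneg)
  then have "spec_norm (c *\<^sub>R Y) = 1"
    using False by (simp add: c_def spec_norm_scaleR)
  moreover have "\<forall>Z. spec_norm Z = 1 \<longrightarrow> sep B C \<le> spec_norm (B ** Z - Z ** C)"
    by (rule sep_attained[of B C]) blast
  ultimately have "sep B C \<le> spec_norm (B ** (c *\<^sub>R Y) - (c *\<^sub>R Y) ** C)"
    by blast
  also have "B ** (c *\<^sub>R Y) - (c *\<^sub>R Y) ** C = c *\<^sub>R (B ** Y - Y ** C)"
    by (simp add: scaleR_matrix_mult matrix_mult_scaleR scaleR_diff_right)
  finally have "sep B C \<le> spec_norm (B ** Y - Y ** C) / spec_norm Y"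
    using pos by (simp only: spec_norm_scaleR) (simp add: c_def)
  then show ?thesis
    using pos by (simp add: pos_le_divide_eq)
qed simp

text \<open>By \<open>sep_mult_le\<close> the operator $Y \mapsto B Y - Y C$ is injective, so it is bijective on the
finite-dimensional space of matrices. Besides real linearity, the inverse also commutes with
complex scalars, written as multiplication by $c I$; this is needed for holomorphy.\<close>

lemma sylvester_inverse:
  fixes B :: "complex^'p^'p" and C :: "complex^'q^'q"
  assumes "sep B C > 0"
  obtains L :: "complex^'q^'p \<Rightarrow> complex^'q^'p"
  where "linear L" "\<And>Y. B ** L Y - L Y ** C = Y" "\<And>Y. L (B ** Y - Y ** C) = Y"
    "\<And>c Y. L (mat c ** Y) = mat c ** L Y" "\<And>Y. sep B C * spec_norm (L Y) \<le> spec_norm Y"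
proof -
  define T where "T = (\<lambda>Y :: complex^'q^'p. B ** Y - Y ** C)"
  have lin: "linear T"
    unfolding T_def
    by (rule linearI)
      (simp_all add: matrix_add_ldistrib matrix_add_left scaleR_matrix_mult matrix_mult_scaleR
        scaleR_diff_right)
  have "Y = 0" if "T Y = 0" for Y
  proof -
    have "sep B C * spec_norm Y \<le> 0"
      using sep_mult_le[of B C Y] that by (simp add: T_def)
    then show "Y = 0"
      using assms spec_norm_nonneg[of Y] by (simp add: mult_le_0_iff)
  qed
  then have "inj T"
    using linear_injective_0[OF lin] by blast
  then obtain L where L: "linear L" "\<And>Y. L (T Y) = Y" "\<And>Y. T (L Y) = Y"
    using linear_injective_isomorphism[OF lin] by metis
  have "L (mat c ** Y) = mat c ** L Y" for c Y
  proof -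
    have "T (mat c ** L Y) = mat c ** T (L Y)"
      by (simp add: T_def matrix_diff_right matrix_mul_assoc mat_commutes)
        (simp add: mat_commutes flip: matrix_mul_assoc)
    then show ?thesis by (metis L(2,3))
  qed
  moreover have "sep B C * spec_norm (L Y) \<le> spec_norm Y" for Y
    using sep_mult_le[of B C "L Y"] L(3)[of Y] by (simp add: T_def)
  ultimately show ?thesis
    using that[of L] L by (simp add: T_def)
qed

section \<open>Small solutions of the Riccati equation\<close>

lemma quadratic_smaller_root:
  fixes a e s :: real
  assumes "0 \<le> a" "0 \<le> e" "0 < s" "4 * e * (e + a) < s\<^sup>2"
  defines "\<rho> \<equiv> 2 * e / (s + sqrt (s\<^sup>2 - 4 * (a + e) * e))"
  shows "0 \<le> \<rho>" "s * \<rho> = e + (a + e) * \<rho>\<^sup>2" "\<rho> \<le> 2 * e / s"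
proof -
  define d where "d = sqrt (s\<^sup>2 - 4 * (a + e) * e)"
  have d: "0 \<le> d" "d\<^sup>2 = s\<^sup>2 - 4 * (a + e) * e"
    using assms(4) by (simp_all add: d_def algebra_simps)
  have \<rho>: "\<rho> = 2 * e / (s + d)"
    by (simp add: \<rho>_def d_def)
  have pos: "s + d > 0"
    using assms(3) d(1) by simp
  show "0 \<le> \<rho>" "\<rho> \<le> 2 * e / s"
    unfolding \<rho> using assms(2,3) d(1) by (auto intro!: divide_left_mono divide_nonneg_nonneg mult_pos_pos)
  have \<rho>': "\<rho> * (s + d) = 2 * e"
    using pos by (simp add: \<rho>)
  have "(s * \<rho>) * (s + d)\<^sup>2 = s * (s + d) * (\<rho> * (s + d))"
    by (simp add: power2_eq_square)
  also have "\<dots> = e * (s + d)\<^sup>2 + e * (s\<^sup>2 - d\<^sup>2)"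
    unfolding \<rho>' by (simp add: power2_eq_square algebra_simps)
  also have "\<dots> = e * (s + d)\<^sup>2 + (a + e) * (\<rho> * (s + d))\<^sup>2"
    unfolding \<rho>' d(2) by (simp add: power2_eq_square algebra_simps)
  also have "\<dots> = (e + (a + e) * \<rho>\<^sup>2) * (s + d)\<^sup>2"
    by (simp only: power_mult_distrib distrib_right mult.assoc)
  finally show "s * \<rho> = e + (a + e) * \<rho>\<^sup>2"
    using pos by simp
qed

text \<open>The witness $t$ is the midpoint of the two roots of $s t = e + (a + e) t^2$. It exceeds $2 e / s$, the
radius within which uniqueness is claimed, and there the quadratic lies strictly below the line.\<close>

lemma quadratic_gap:
  fixes a e s :: real
  assumes "0 \<le> a" "0 < e" "0 < s" "4 * e * (e + a) < s\<^sup>2"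
  defines "t \<equiv> s / (2 * (a + e))"
  shows "2 * e / s < t" "(e + (a + e) * t\<^sup>2) / s < t"
proof -
  have pos: "a + e > 0" using assms by simp
  then show "2 * e / s < t"
    using assms by (simp add: t_def field_simps power2_eq_square)
  have t: "2 * (a + e) * t = s"
    using pos by (simp add: t_def)
  have "4 * (a + e) * (e + (a + e) * t\<^sup>2) = 4 * e * (e + a) + (2 * (a + e) * t)\<^sup>2"
    by (simp add: power2_eq_square algebra_simps)
  also have "\<dots> < 2 * s\<^sup>2"
    unfolding t using assms(4) by simp
  also have "\<dots> = 4 * (a + e) * (s * t)"
    using t by (simp add: power2_eq_square algebra_simps flip: t)
  finally have "e + (a + e) * t\<^sup>2 < s * t"
    using pos by simp
  then show "(e + (a + e) * t\<^sup>2) / s < t"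
    using assms(3) by (simp add: field_simps)
qed

text \<open>Existence comes from Brouwer's theorem on the ball whose radius is the smaller root, uniqueness from
the holomorphic fixed point lemma on the open ball whose radius is the midpoint of the roots. If $e = 0$,
both radii in the statement are zero and uniqueness is trivial; this case is split off because the
midpoint $s / (2 (a + e))$ is meaningful only if $a + e > 0$.\<close>

lemma riccati_solution:
  fixes A11 E11 :: "complex^'m^'m" and A12 E12 :: "complex^'k^'m"
    and E21 :: "complex^'m^'k" and A22 E22 :: "complex^'k^'k"
  defines "a \<equiv> spec_norm A12" and "e \<equiv> spec_norm (four_block E11 E12 E21 E22)"
    and "s \<equiv> sep A22 A11"
  assumes s_pos: "s > 0" and small: "4 * e * (e + a) < s\<^sup>2"
  defines "riccati \<equiv> (\<lambda>X. E21 + (A22 + E22) ** X = X ** (A11 + E11 + (A12 + E12) ** X))"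
  shows "\<exists>X. riccati X \<and> spec_norm X \<le> 2 * e / (s + sqrt (s\<^sup>2 - 4 * (a + e) * e)) \<and>
    (\<forall>X'. riccati X' \<and> spec_norm X' \<le> 2 * e / s \<longrightarrow> X' = X)"
proof -
  have nonneg: "0 \<le> a" "0 \<le> e"
    by (simp_all add: a_def e_def spec_norm_nonneg)
  obtain L :: "complex^'m^'k \<Rightarrow> complex^'m^'k"
    where lin: "linear L" and TL: "\<And>Y. A22 ** L Y - L Y ** A11 = Y"
      and LT: "\<And>Y. L (A22 ** Y - Y ** A11) = Y"
      and hom: "\<And>c Y. L (mat c ** Y) = mat c ** L Y"
      and L_le: "\<And>Y. s * spec_norm (L Y) \<le> spec_norm Y"
    using sylvester_inverse[of A22 A11] s_pos unfolding s_def by blast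
  define F where "F = (\<lambda>X. X ** A12 ** X - (E21 + E22 ** X - X ** (E11 + E12 ** X)))"
  define \<Phi> where "\<Phi> = (\<lambda>X. L (F X))"
  have riccati_iff: "riccati X \<longleftrightarrow> \<Phi> X = X" for X
  proof -
    have "riccati X \<longleftrightarrow> A22 ** X - X ** A11 = F X"
      by (simp add: riccati_def F_def matrix_add_ldistrib matrix_add_left matrix_mul_assoc
          algebra_simps)
    also have "\<dots> \<longleftrightarrow> \<Phi> X = X"
      unfolding \<Phi>_def by (metis TL LT)
    finally show ?thesis .
  qed
  have \<Phi>_le: "s * spec_norm (\<Phi> X) \<le> e + (a + e) * r\<^sup>2" if "spec_norm X \<le> r" for X r
  proof -
    have "spec_norm (X ** A12 ** X) \<le> spec_norm X * a * spec_norm X"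
      using spec_norm_mult[of "X ** A12" X]
        mult_right_mono[OF spec_norm_mult[of X A12] spec_norm_nonneg[of X]]
      by (simp add: a_def)
    then have "spec_norm (F X) \<le> a * (spec_norm X)\<^sup>2 + e * (1 + (spec_norm X)\<^sup>2)"
      using spec_norm_diff[of "X ** A12 ** X" "E21 + E22 ** X - X ** (E11 + E12 ** X)"]
        spec_norm_riccati_perturbation_le[of E21 E22 X E11 E12]
      by (simp add: F_def e_def power2_eq_square mult.commute mult.left_commute)
    also have "\<dots> = e + (a + e) * (spec_norm X)\<^sup>2"
      by (simp add: algebra_simps)
    also have "\<dots> \<le> e + (a + e) * r\<^sup>2"
      using that nonneg by (intro add_left_mono mult_left_mono power_mono spec_norm_nonneg) auto
    finally show ?thesis
      using L_le[of "F X"] by (simp add: \<Phi>_def)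
  qed
  have hol: "entrywise_holomorphic \<Phi>"
    unfolding \<Phi>_def F_def
    by (intro entrywise_holomorphic_linear[OF lin hom] entrywise_holomorphic_diff entrywise_holomorphic_add
        entrywise_holomorphic_mult entrywise_holomorphic_id entrywise_holomorphic_const)
  have diff: "\<Phi> differentiable (at Z)" for Z
  proof -
    have "F differentiable (at Z)"
      unfolding F_def
      by (intro differentiable_diff differentiable_add differentiable_matrix_mult
          differentiable_ident differentiable_const)
    moreover have "L differentiable (at (F Z))"
      using lin by (rule linear_imp_differentiable)
    ultimately show ?thesis
      unfolding \<Phi>_def using differentiable_chain_at[of F Z L] by (simp add: o_def)
  qed
  define \<rho> where "\<rho> = 2 * e / (s + sqrt (s\<^sup>2 - 4 * (a + e) * e))"
  note root = quadratic_smaller_root[OF nonneg s_pos small, folded \<rho>_def]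
  obtain X where X: "spec_norm X \<le> \<rho>" "\<Phi> X = X"
  proof (rule brouwer[of "{X :: complex^'m^'k. spec_norm X \<le> \<rho>}" \<Phi>])
    show "continuous_on {X. spec_norm X \<le> \<rho>} \<Phi>"
      by (intro continuous_at_imp_continuous_on ballI differentiable_imp_continuous_within diff)
    have "0 \<in> {X :: complex^'m^'k. spec_norm X \<le> \<rho>}"
      using root(1) by simp
    then show "{X :: complex^'m^'k. spec_norm X \<le> \<rho>} \<noteq> {}" by blast
    show "\<Phi> \<in> {X. spec_norm X \<le> \<rho>} \<rightarrow> {X. spec_norm X \<le> \<rho>}"
      using \<Phi>_le[of _ \<rho>] s_pos by (auto simp flip: root(2))
  qed (use compact_spec_norm_ball convex_spec_norm_ball in auto)
  have "X' = X" if X': "\<Phi> X' = X'" "spec_norm X' \<le> 2 * e / s" for X'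
  proof (cases "e = 0")
    case True
    then have "spec_norm X' = 0" "spec_norm X = 0"
      using X'(2) X(1) spec_norm_nonneg[of X'] spec_norm_nonneg[of X] by (simp_all add: \<rho>_def)
    then show ?thesis by simp
  next
    case False
    define t where "t = s / (2 * (a + e))"
    have gap: "2 * e / s < t" "(e + (a + e) * t\<^sup>2) / s < t"
      using quadratic_gap[of a e s] nonneg s_pos small False by (auto simp: t_def)
    have "spec_norm X \<le> 2 * e / s"
      using X(1) root(3) by simp
    show ?thesis
    proof (rule holomorphic_self_map_unique_fixed_point[OF hol diff gap(2)])
      show "spec_norm (\<Phi> Z) \<le> (e + (a + e) * t\<^sup>2) / s" if "spec_norm Z < t" for Z
        using \<Phi>_le[of Z t] that s_pos by (simp add: field_simps)
    qed (use X X' gap \<open>spec_norm X \<le> 2 * e / s\<close> in auto)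
  qed
  then show ?thesis
    using X by (auto simp: riccati_iff \<rho>_def)
qed

theorem theorem3p19:
  fixes A11 E11 :: "complex^'m^'m" and A12 E12 :: "complex^'k^'m"
    and E21 :: "complex^'m^'k" and A22 E22 :: "complex^'k^'k"
    and A E :: "complex^('m + 'k)^('m + 'k)"
    and s :: real
    and M :: "complex^'m^'k \<Rightarrow> complex^'m^'m" and N :: "complex^'m^'k \<Rightarrow> complex^'k^'k"
  assumes A: "A = four_block A11 A12 0 A22"
    and E: "E = four_block E11 E12 E21 E22"
    and s: "s = sep A22 A11"
    and s_pos: "s > 0"
    and small: "4 * spec_norm E * (spec_norm E + spec_norm A12) < s\<^sup>2"
    and M: "M = (\<lambda>X. A11 + E11 + (A12 + E12) ** X)"
    and N: "N = (\<lambda>X. A22 + E22 - X ** (A12 + E12))"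
  shows "\<exists>X :: complex^'m^'k.
    \<comment> \<open>(a)\<close>
    right_invariant_pair (A + E) (two_block (mat 1) X) (M X) \<and>
    left_invariant_pair (A + E) (two_block (- ctranspose X) (mat 1)) (N X) \<and>
    (\<forall>X'. right_invariant_pair (A + E) (two_block (mat 1) X') (M X') \<and>
          left_invariant_pair (A + E) (two_block (- ctranspose X') (mat 1)) (N X') \<and>
          spec_norm X' \<le> 2 * spec_norm E / s
          \<longrightarrow> X' = X) \<and>
    \<comment> \<open>(b)\<close>
    (let \<X> = col_span (two_block (mat 1) 0 :: complex^'m^('m + 'k));
         \<X>\<^sub>E = col_span (two_block (mat 1) X)
     in (*v) A ` \<X> \<subseteq> \<X> \<and> (*v) (A + E) ` \<X>\<^sub>E \<subseteq> \<X>\<^sub>E \<and>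
        tan (theta_max TYPE('m) \<X> \<X>\<^sub>E) = spec_norm X \<and>
        spec_norm X \<le> 2 * spec_norm E /
          (s + sqrt (s\<^sup>2 - 4 * (spec_norm A12 + spec_norm E) * spec_norm E)) \<and>
        2 * spec_norm E /
          (s + sqrt (s\<^sup>2 - 4 * (spec_norm A12 + spec_norm E) * spec_norm E))
          \<le> 2 * spec_norm E / s) \<and>
    \<comment> \<open>(c)\<close>
    (let \<Y> = col_span (two_block 0 (mat 1) :: complex^'k^('m + 'k));
         \<Y>\<^sub>E = col_span (two_block (- ctranspose X) (mat 1))
     in (*v) (ctranspose A) ` \<Y> \<subseteq> \<Y> \<and> (*v) (ctranspose (A + E)) ` \<Y>\<^sub>E \<subseteq> \<Y>\<^sub>E \<and>
        tan (theta_max TYPE('k) \<Y> \<Y>\<^sub>E) = spec_norm X \<and>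
        spec_norm X \<le> 2 * spec_norm E /
          (s + sqrt (s\<^sup>2 - 4 * (spec_norm A12 + spec_norm E) * spec_norm E)) \<and>
        2 * spec_norm E /
          (s + sqrt (s\<^sup>2 - 4 * (spec_norm A12 + spec_norm E) * spec_norm E))
          \<le> 2 * spec_norm E / s)"
proof -
  define \<rho> where "\<rho> = 2 * spec_norm E / (s + sqrt (s\<^sup>2 - 4 * (spec_norm A12 + spec_norm E) * spec_norm E))"
  have \<rho>_le: "\<rho> \<le> 2 * spec_norm E / s"
    unfolding \<rho>_def
    by (rule quadratic_smaller_root(3)) (use s_pos small in \<open>auto simp: spec_norm_nonneg\<close>)
  have AE: "A + E = four_block (A11 + E11) (A12 + E12) E21 (A22 + E22)"
    by (simp add: A E four_block_add)
  define riccati where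
    "riccati X \<longleftrightarrow> E21 + (A22 + E22) ** X = X ** (A11 + E11 + (A12 + E12) ** X)" for X
  have right: "right_invariant_pair (A + E) (two_block (mat 1) X) (M X) \<longleftrightarrow> riccati X" for X
    unfolding AE M riccati_def by (rule right_invariant_pair_iff_riccati)
  have left: "left_invariant_pair (A + E) (two_block (- ctranspose X) (mat 1)) (N X) \<longleftrightarrow> riccati X" for X
    unfolding AE N riccati_def by (rule left_invariant_pair_iff_riccati)
  obtain X where X: "riccati X" "spec_norm X \<le> \<rho>"
    and unique: "\<And>X'. riccati X' \<Longrightarrow> spec_norm X' \<le> 2 * spec_norm E / s \<Longrightarrow> X' = X"
    using riccati_solution[of A22 A11 E11 E12 E21 E22 A12] s_pos small
    unfolding riccati_def \<rho>_def E s by metis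
  let ?I = "two_block (mat 1) 0 :: complex^'m^('m + 'k)"
  let ?J = "two_block 0 (mat 1) :: complex^'k^('m + 'k)"
  let ?V = "two_block (mat 1) X :: complex^'m^('m + 'k)"
  let ?W = "two_block (- ctranspose X) (mat 1) :: complex^'k^('m + 'k)"
  have "A ** ?I = ?I ** A11"
    by (simp add: A four_block_mult_two_block two_block_mult)
  then have b1: "(*v) A ` col_span ?I \<subseteq> col_span ?I"
    by (rule invariant_col_span)
  have b2: "(*v) (A + E) ` col_span ?V \<subseteq> col_span ?V"
    using X(1) unfolding right[symmetric] right_invariant_pair_def
    by (intro invariant_col_span) (elim conjE)
  have b3: "tan (theta_max TYPE('m) (col_span ?I) (col_span ?V)) = spec_norm X"
    by (rule tan_theta_max_eq_spec_norm) (simp_all add: ctranspose_two_block_mult)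
  have "ctranspose A ** ?J = ?J ** ctranspose A22"
    by (simp add: A ctranspose_four_block four_block_mult_two_block two_block_mult)
  then have c1: "(*v) (ctranspose A) ` col_span ?J \<subseteq> col_span ?J"
    by (rule invariant_col_span)
  have "ctranspose ?W ** (A + E) = N X ** ctranspose ?W"
    using X(1) unfolding left[symmetric] left_invariant_pair_def by simp
  then have "ctranspose (A + E) ** ?W = ?W ** ctranspose (N X)"
    by (metis ctranspose_mult ctranspose_ctranspose)
  then have c2: "(*v) (ctranspose (A + E)) ` col_span ?W \<subseteq> col_span ?W"
    by (rule invariant_col_span)
  have "tan (theta_max TYPE('k) (col_span ?J) (col_span ?W)) = spec_norm (- ctranspose X)"
    by (rule tan_theta_max_eq_spec_norm) (simp_all add: ctranspose_two_block_mult)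
  then have c3: "tan (theta_max TYPE('k) (col_span ?J) (col_span ?W)) = spec_norm X"
    by (simp add: spec_norm_minus)
  show ?thesis
    unfolding Let_def right left \<rho>_def[symmetric]
    using X unique \<rho>_le b1 b2 b3 c1 c2 c3 by blast
qed

end
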